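(* Let $N\ge1$ be an integer, let $\lambda>0$, let $h_0^\lambda(t)=e^{-\pi\lambda t^2}$, and let $z_1,\dots,z_K\in\mathbb{T}_N^2$ be a collection of $K$ distinct points. The following are equivalent: 1) The points $z_1,\dots,z_K\in\mathbb{T}_N^2$ give rise to a frame for $S_N$, i.e., there are constants $A,B>0$ such that, for every $\varphi\in S_N$, $$A\|\varphi\|_{S_N}^2\le\sum_{k=1}^K|\mathbf{V}_{h_0^\lambda}\varphi(z_k)|^2\le B\|\varphi\|_{S_N}^2 .$$ 2) One of the following two conditions is satisfied: (i) $K\ge N+1$; (ii) $K=N$ and $\frac1N\sum_{k=1}^N z_k\ne\left(\frac12+\frac nN,\frac N2+m\right)$ for every $n,m\in\mathbb{Z}$.
   Context: For $x,\xi\in\mathbb{R}$ let $\mathbf{T}_x f(t)=f(t-x)$, $\mathbf{M}_\xi f(t)=e^{2\pi i\xi t}f(t)$ and $\pi(x,\xi)=\mathbf{M}_\xi\mathbf{T}_x$. For $f,g\in L^2(\mathbb{R})$ the short-time Fourier transform (STFT) is $\mathbf{V}_g f(x,\xi)=\langle f,\pi(x,\xi)g\rangle$. With $h_0(t)=e^{-\pi t^2}$, the Feichtinger algebra is $S_0(\mathbb{R})=\{f\in L^2(\mathbb{R}):\mathbf{V}_{h_0}f\in L^1(\mathbb{R}^2)\}$ with norm $\|f\|_{S_0}=\|\mathbf{V}_{h_0}f\|_{L^1(\mathbb{R}^2)}$; its dual is $S_0'(\mathbb{R})$. The duality pairing $\langle\cdot,\cdot\rangle_{S_0'\times S_0}$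 is linear in the first and antilinear in the second argument (so $\langle\delta_t,g\rangle=\overline{g(t)}$). For $\varphi\in S_0'(\mathbb{R})$ and $g\in S_0(\mathbb{R})$, the STFT is $\mathbf{V}_g\varphi(x,\xi)=\langle\varphi,\pi(x,\xi)g\rangle_{S_0'\times S_0}$. $S_N\subset S_0'(\mathbb{R})$ is the linear span of the delta trains $\epsilon_n=\sum_{k\in\mathbb{Z}}\delta_{\frac nN+k}$, $n=0,\dots,N-1$, which form a basis of $S_N$. For $\varphi=\sum_{n=0}^{N-1}a_n\epsilon_n$ and $\psi=\sum_{n=0}^{N-1}b_n\epsilon_n$ one sets $\langle\varphi,\psi\rangle_{S_N}=\sum_{n=0}^{N-1}a_n\overline{b_n}$, with induced norm $\|\cdot\|_{S_N}$. The flat torus is $\mathbb{T}_N^2=\mathbb{R}^2/(\mathbb{Z}\times N\mathbb{Z})$, represented by $[0,1]\times[0,N]$ with opposite sides identified; "distinct" means distinct as elements of the quotient. For $\varphi\in S_N$ one has $\mathbf{V}_g\varphi(x+1,\xi)=e^{-2\pi i\xi}\mathbf{V}_g\varphi(x,\xi)$ and $\mathbf{V}_g\varphi(x,\xi+N)=\mathbf{V}_g\varphi(x,\xi)$, so $|\mathbf{V}_g\varphi|$ is well-defined on $\mathbb{T}_N^2$. In (ii), $\sum_k z_k$ is the sum in $\mathbb{R}^2$ of representatives $z_k=(x_k,\xi_k)$ in $[0,1]\times[0,N]$ (the condition does not depend on the choice of representatives). *)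

theory Defs
  imports "HOL-Probability.Probability" "HOL-Real_Asymp.Real_Asymp"
begin

definition transl :: "real \<Rightarrow> (real \<Rightarrow> complex) \<Rightarrow> real \<Rightarrow> complex" where
  "transl x f = (\<lambda>t. f (t - x))"

definition modul :: "real \<Rightarrow> (real \<Rightarrow> complex) \<Rightarrow> real \<Rightarrow> complex" where
  "modul \<xi> f = (\<lambda>t. exp (2 * complex_of_real pi * \<i> * complex_of_real \<xi> * complex_of_real t) * f t)"

definition tf_shift :: "real \<times> real \<Rightarrow> (real \<Rightarrow> complex) \<Rightarrow> real \<Rightarrow> complex" where
  "tf_shift z g = modul (snd z) (transl (fst z) g)"

definition L2_fun :: "(real \<Rightarrow> complex) set" where
  "L2_fun = {f \<in> borel_measurable lborel. integrable lborel (\<lambda>t. (cmod (f t))\<^sup>2)}"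

definition L2_inner :: "(real \<Rightarrow> complex) \<Rightarrow> (real \<Rightarrow> complex) \<Rightarrow> complex" where
  "L2_inner f g = (LINT t|lborel. f t * cnj (g t))"

definition stft :: "(real \<Rightarrow> complex) \<Rightarrow> (real \<Rightarrow> complex) \<Rightarrow> real \<times> real \<Rightarrow> complex" where
  "stft g f z = L2_inner f (tf_shift z g)"

definition gauss :: "real \<Rightarrow> real \<Rightarrow> complex" where
  "gauss lam = (\<lambda>t. complex_of_real (exp (- pi * lam * t\<^sup>2)))"

text \<open>
  Every class in the Feichtinger algebra has exactly one continuous representative, and point
  evaluations refer to that representative; the algebra is therefore modelled as a set of
  continuous functions.
\<close>

definition S0 :: "(real \<Rightarrow> complex) set" where
  "S0 = {f \<in> L2_fun. continuous_on UNIV f \<and> integrable lborel (stft (gauss 1) f)}"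

definition S0_norm :: "(real \<Rightarrow> complex) \<Rightarrow> real" where
  "S0_norm f = (LINT z|lborel. cmod (stft (gauss 1) f z))"

text \<open>
  The duality pairing is antilinear in its second argument, so a distribution is identified with
  the bounded antilinear functional that pairing with it defines on \<^const>\<open>S0\<close>, and the pairing
  is function application.  Functionals vanish outside \<^const>\<open>S0\<close>, so that equality of
  distributions is equality of functions.
\<close>

type_synonym functional = "(real \<Rightarrow> complex) \<Rightarrow> complex"

definition S0_dual :: "functional set" where
  "S0_dual = {\<phi>.
     (\<forall>f\<in>S0. \<forall>g\<in>S0. \<phi> (\<lambda>t. f t + g t) = \<phi> f + \<phi> g) \<and>
     (\<forall>c. \<forall>f\<in>S0. \<phi> (\<lambda>t. c * f t) = cnj c * \<phi> f) \<and>
     (\<exists>C. \<forall>f\<in>S0. cmod (\<phi> f) \<le> C * S0_norm f) \<and>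
     (\<forall>f. f \<notin> S0 \<longrightarrow> \<phi> f = 0)}"

definition dual_stft :: "(real \<Rightarrow> complex) \<Rightarrow> functional \<Rightarrow> real \<times> real \<Rightarrow> complex" where
  "dual_stft g \<phi> z = \<phi> (tf_shift z g)"

definition delta :: "real \<Rightarrow> functional" where
  "delta t = (\<lambda>g. if g \<in> S0 then cnj (g t) else 0)"

definition delta_train :: "nat \<Rightarrow> nat \<Rightarrow> functional" where
  "delta_train N n = (\<lambda>g. \<Sum>\<^sub>\<infinity>k\<in>(UNIV :: int set). delta (real n / real N + of_int k) g)"

definition train_comb :: "nat \<Rightarrow> (nat \<Rightarrow> complex) \<Rightarrow> functional" where
  "train_comb N a = (\<lambda>g. \<Sum>n<N. a n * delta_train N n g)"

definition SN :: "nat \<Rightarrow> functional set" where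
  "SN N = range (train_comb N)"

text \<open>The coefficients with respect to the basis \<open>\<epsilon>\<^sub>0, \<dots>, \<epsilon>\<^bsub>N-1\<^esub>\<close>, extended by 0.\<close>

definition SN_coeff :: "nat \<Rightarrow> functional \<Rightarrow> nat \<Rightarrow> complex" where
  "SN_coeff N \<phi> = (THE a. (\<forall>n\<ge>N. a n = 0) \<and> \<phi> = train_comb N a)"

definition SN_inner :: "nat \<Rightarrow> functional \<Rightarrow> functional \<Rightarrow> complex" where
  "SN_inner N \<phi> \<psi> = (\<Sum>n<N. SN_coeff N \<phi> n * cnj (SN_coeff N \<psi> n))"

definition SN_norm :: "nat \<Rightarrow> functional \<Rightarrow> real" where
  "SN_norm N \<phi> = sqrt (Re (SN_inner N \<phi> \<phi>))"

text \<open>Equality in \<open>\<real>\<^sup>2 / (\<int> \<times> N\<int>)\<close> of the points represented by \<open>z\<close> and \<open>w\<close>.\<close>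

definition torus_eq :: "nat \<Rightarrow> real \<times> real \<Rightarrow> real \<times> real \<Rightarrow> bool" where
  "torus_eq N z w \<longleftrightarrow>
     (\<exists>i j :: int. fst z - fst w = of_int i \<and> snd z - snd w = real N * of_int j)"

definition gives_frame :: "nat \<Rightarrow> (real \<Rightarrow> complex) \<Rightarrow> nat \<Rightarrow> (nat \<Rightarrow> real \<times> real) \<Rightarrow> bool" where
  "gives_frame N g K z \<longleftrightarrow>
     (\<exists>A>0. \<exists>B>0. \<forall>\<phi>\<in>SN N.
        A * (SN_norm N \<phi>)\<^sup>2 \<le> (\<Sum>k=1..K. (cmod (dual_stft g \<phi> (z k)))\<^sup>2) \<and>
        (\<Sum>k=1..K. (cmod (dual_stft g \<phi> (z k)))\<^sup>2) \<le> B * (SN_norm N \<phi>)\<^sup>2)"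

text \<open>
  The delta trains are bounded on \<^const>\<open>S0\<close>, and their defining sums converge absolutely: for almost
  every \<open>x\<close>, Gaussian summability bounds \<open>f(s) h\<^sub>0(s - x)\<close> by the integral of \<open>|V f(x, \<xi>)|\<close> over \<open>\<xi>\<close>, and
  integrating over \<open>x\<close> in \<open>[s, s + 1)\<close> gives \<open>\<Sum>k. |f(t + k)| \<le> e\<^sup>\<pi> \<parallel>f\<parallel>\<close>.
\<close>

lemma std_normal_fourier:
  "integrable lborel (\<lambda>x. complex_of_real (std_normal_density x) * iexp (t * x))"
  "(LINT x|lborel. complex_of_real (std_normal_density x) * iexp (t * x)) = complex_of_real (exp (- t\<^sup>2 / 2))"
proof -
  show "integrable lborel (\<lambda>x. complex_of_real (std_normal_density x) * iexp (t * x))"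
    by (rule Bochner_Integration.integrable_bound[of _ std_normal_density]) (auto simp: norm_mult)
  have "(LINT x|lborel. complex_of_real (std_normal_density x) * iexp (t * x)) = char std_normal_distribution t"
    unfolding char_def by (subst integral_density) (auto simp: scaleR_conv_of_real)
  then show "(LINT x|lborel. complex_of_real (std_normal_density x) * iexp (t * x)) = complex_of_real (exp (- t\<^sup>2 / 2))"
    by (simp add: char_std_normal_distribution)
qed

lemma normal_kernel_tendsto:
  fixes F :: "real \<Rightarrow> complex"
  assumes cont: "continuous_on UNIV F" and int: "integrable lborel F"
  shows "(\<lambda>n. LINT u|lborel. complex_of_real (real (Suc n) * std_normal_density (real (Suc n) * (u - s))) * F u) \<longlonglongrightarrow> F s"
proof -
  define D where "D n u = real (Suc n) * std_normal_density (real (Suc n) * (u - s))" for n u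
  have Fm[measurable]: "F \<in> borel_measurable borel" using int by auto
  have Dm[measurable]: "D n \<in> borel_measurable borel" for n unfolding D_def by measurable
  have D0: "D n u \<ge> 0" for n u unfolding D_def by simp
  define I where "I = {s-1<..<s+1}"
  have Im[measurable]: "I \<in> sets borel" unfolding I_def by simp
  have "bounded (F ` {s-1..s+1})"
    by (intro compact_imp_bounded compact_continuous_image continuous_on_subset[OF cont]) auto
  then obtain M where M: "\<And>u. u \<in> {s-1..s+1} \<Longrightarrow> cmod (F u) \<le> M" unfolding bounded_iff by (meson imageI)
  have M0: "M \<ge> 0" using order_trans[OF norm_ge_zero M[of s]] by simp
  have ub: "D n u \<le> real (Suc n)" for n u
  proof -
    have "1 / sqrt (2*pi) * exp (- (real (Suc n) * (u - s))\<^sup>2 / 2) \<le> 1 * 1"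
      using pi_ge_two by (intro mult_mono) (auto simp: )
    then have "std_normal_density (real (Suc n) * (u - s)) \<le> 1" unfolding std_normal_density_def by simp
    then show ?thesis unfolding D_def by (intro mult_left_le) simp_all
  qed
  have intDF: "integrable lborel (\<lambda>u. complex_of_real (D n u) * F u)" for n
    by (rule Bochner_Integration.integrable_bound[OF integrable_norm[OF integrable_mult_right[OF int, of "of_nat (Suc n)"]]])
       (use ub D0 in \<open>auto simp: norm_mult intro!: mult_right_mono simp del: of_nat_Suc\<close>)
  have near: "(\<lambda>n. LINT u|lborel. indicator I u *\<^sub>R (complex_of_real (D n u) * F u)) \<longlonglongrightarrow> F s"
  proof -
    have eq: "(LINT u|lborel. indicator I u *\<^sub>R (complex_of_real (D n u) * F u)) =
       (LINT v|lborel. indicator I (s + v / real (Suc n)) *\<^sub>R (complex_of_real (std_normal_density v) * F (s + v / real (Suc n))))" for n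
    proof -
      have "(LINT u|lborel. indicator I u *\<^sub>R (complex_of_real (D n u) * F u)) =
        \<bar>1/real (Suc n)\<bar> *\<^sub>R (LINT v|lborel. indicator I (s + (1/real (Suc n)) * v) *\<^sub>R (complex_of_real (D n (s + (1/real (Suc n)) * v)) * F (s + (1/real (Suc n)) * v)))"
        by (rule lborel_integral_real_affine) simp
      also have "\<dots> = (LINT v|lborel. (1/real (Suc n)) *\<^sub>R (indicator I (s + (1/real (Suc n)) * v) *\<^sub>R (complex_of_real (D n (s + (1/real (Suc n)) * v)) * F (s + (1/real (Suc n)) * v))))"
        by (simp only: integral_scaleR_right) simp
      also have "\<dots> = (LINT v|lborel. indicator I (s + v / real (Suc n)) *\<^sub>R (complex_of_real (std_normal_density v) * F (s + v / real (Suc n))))"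
        by (intro Bochner_Integration.integral_cong refl)
           (simp add: D_def scaleR_conv_of_real divide_simps del: of_nat_Suc)
      finally show ?thesis .
    qed
    have lim1: "(LINT v|lborel. complex_of_real (std_normal_density v) * F s) = F s"
      using std_normal_fourier(2)[of 0] by simp
    have "(\<lambda>n. LINT v|lborel. indicator I (s + v / real (Suc n)) *\<^sub>R (complex_of_real (std_normal_density v) * F (s + v / real (Suc n))))
        \<longlonglongrightarrow> (LINT v|lborel. complex_of_real (std_normal_density v) * F s)"
    proof (rule integral_dominated_convergence[where w="\<lambda>v. M * std_normal_density v"])
      show "AE v in lborel. (\<lambda>n. indicator I (s + v / real (Suc n)) *\<^sub>R (complex_of_real (std_normal_density v) * F (s + v / real (Suc n)))) \<longlonglongrightarrow> complex_of_real (std_normal_density v) * F s"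
      proof (rule AE_I2)
        fix v :: real
        have t: "(\<lambda>n. s + v / real (Suc n)) \<longlonglongrightarrow> s" by real_asymp
        have "isCont F s" using cont by (simp add: continuous_on_eq_continuous_at)
        then have "(\<lambda>n. F (s + v / real (Suc n))) \<longlonglongrightarrow> F s" using t by (rule isCont_tendsto_compose)
        moreover have "eventually (\<lambda>n. s + v / real (Suc n) \<in> I) sequentially"
          using t by (rule topological_tendstoD) (auto simp: I_def)
        ultimately show "(\<lambda>n. indicator I (s + v / real (Suc n)) *\<^sub>R (complex_of_real (std_normal_density v) * F (s + v / real (Suc n)))) \<longlonglongrightarrow> complex_of_real (std_normal_density v) * F s"
          by (intro Lim_transform_eventually[OF tendsto_mult[OF tendsto_const, of "\<lambda>n. F (s + v / real (Suc n))" "F s" _ "complex_of_real (std_normal_density v)"]])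
             (auto elim!: eventually_mono)
      qed
      show "AE v in lborel. norm (indicator I (s + v / real (Suc n)) *\<^sub>R (complex_of_real (std_normal_density v) * F (s + v / real (Suc n)))) \<le> M * std_normal_density v" for n
      proof (rule AE_I2)
        fix v :: real
        show "norm (indicator I (s + v / real (Suc n)) *\<^sub>R (complex_of_real (std_normal_density v) * F (s + v / real (Suc n)))) \<le> M * std_normal_density v"
        proof (cases "s + v / real (Suc n) \<in> I")
          case True
          then have "cmod (F (s + v / real (Suc n))) \<le> M" by (intro M) (auto simp: I_def)
          then show ?thesis using True mult_right_mono[of "cmod (F (s + v / real (Suc n)))" M "std_normal_density v"] by (simp add: norm_mult mult.commute)
        qed (use M0 in simp)
      qed
    qed auto
    then show ?thesis unfolding eq lim1 .
  qed
  have far: "(\<lambda>n. LINT u|lborel. indicator (-I) u *\<^sub>R (complex_of_real (D n u) * F u)) \<longlonglongrightarrow> 0"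
  proof (rule Lim_null_comparison)
    show "(\<lambda>n. (real (Suc n) * exp (- (real (Suc n))\<^sup>2 / 2)) * (LINT u|lborel. cmod (F u))) \<longlonglongrightarrow> 0"
      by (rule tendsto_mult_left_zero) real_asymp
    have "norm (LINT u|lborel. indicator (-I) u *\<^sub>R (complex_of_real (D n u) * F u)) \<le> (real (Suc n) * exp (- (real (Suc n))\<^sup>2 / 2)) * (LINT u|lborel. cmod (F u))" for n
    proof -
      have "norm (LINT u|lborel. indicator (-I) u *\<^sub>R (complex_of_real (D n u) * F u)) \<le> (LINT u|lborel. (real (Suc n) * exp (- (real (Suc n))\<^sup>2 / 2)) * cmod (F u))"
      proof (rule Bochner_Integration.integral_norm_bound_integral)
        show "integrable lborel (\<lambda>u. indicator (-I) u *\<^sub>R (complex_of_real (D n u) * F u))"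
          using intDF[of n] by (intro integrable_mult_indicator) auto
        show "integrable lborel (\<lambda>u. (real (Suc n) * exp (- (real (Suc n))\<^sup>2 / 2)) * cmod (F u))"
          using int by auto
        fix u
        show "norm (indicator (-I) u *\<^sub>R (complex_of_real (D n u) * F u)) \<le> (real (Suc n) * exp (- (real (Suc n))\<^sup>2 / 2)) * cmod (F u)"
        proof (cases "u \<in> I")
          case False
          then have "\<bar>u - s\<bar> \<ge> 1" by (auto simp: I_def)
          then have "\<bar>u - s\<bar>\<^sup>2 \<ge> 1" using power_mono[of 1 "\<bar>u-s\<bar>" 2] by simp
          then have "(real (Suc n))\<^sup>2 * 1 \<le> (real (Suc n))\<^sup>2 * (u - s)\<^sup>2" by (intro mult_left_mono) auto
          then have "1 / sqrt (2*pi) * exp (- (real (Suc n) * (u - s))\<^sup>2 / 2) \<le> 1 * exp (- (real (Suc n))\<^sup>2 / 2)"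
            using pi_ge_two by (intro mult_mono) (auto simp: power_mult_distrib simp del: of_nat_Suc)
          then have "std_normal_density (real (Suc n) * (u - s)) \<le> exp (- (real (Suc n))\<^sup>2 / 2)"
            unfolding std_normal_density_def by (simp del: of_nat_Suc)
          then have "D n u \<le> real (Suc n) * exp (- (real (Suc n))\<^sup>2 / 2)"
            unfolding D_def by (rule mult_left_mono) simp
          then show ?thesis using False D0[of n u] by (simp add: norm_mult mult_right_mono del: of_nat_Suc)
        qed auto
      qed
      then show ?thesis by simp
    qed
    then show "\<forall>\<^sub>F n in sequentially. norm (LINT u|lborel. indicator (-I) u *\<^sub>R (complex_of_real (D n u) * F u)) \<le> (real (Suc n) * exp (- (real (Suc n))\<^sup>2 / 2)) * (LINT u|lborel. cmod (F u))"
      by simp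
  qed
  have "(LINT u|lborel. complex_of_real (D n u) * F u) = (LINT u|lborel. indicator I u *\<^sub>R (complex_of_real (D n u) * F u)) + (LINT u|lborel. indicator (-I) u *\<^sub>R (complex_of_real (D n u) * F u))" for n
  proof -
    have "(LINT u|lborel. indicator I u *\<^sub>R (complex_of_real (D n u) * F u)) + (LINT u|lborel. indicator (-I) u *\<^sub>R (complex_of_real (D n u) * F u))
       = (LINT u|lborel. indicator I u *\<^sub>R (complex_of_real (D n u) * F u) + indicator (-I) u *\<^sub>R (complex_of_real (D n u) * F u))"
      using intDF[of n] by (intro Bochner_Integration.integral_add[symmetric] integrable_mult_indicator) auto
    also have "\<dots> = (LINT u|lborel. complex_of_real (D n u) * F u)"
      by (intro Bochner_Integration.integral_cong refl) (auto simp: indicator_def)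
    finally show ?thesis by simp
  qed
  then have "(\<lambda>n. LINT u|lborel. complex_of_real (D n u) * F u) \<longlonglongrightarrow> F s"
    using tendsto_add[OF near far] by simp
  then show ?thesis unfolding D_def .
qed

lemma norm_le_fourier_L1:
  fixes F :: "real \<Rightarrow> complex"
  assumes cont: "continuous_on UNIV F" and int: "integrable lborel F"
    and hat: "\<And>\<xi>. Fh \<xi> = (LINT u|lborel. F u * iexp (- (2 * pi * \<xi> * u)))"
    and inth: "integrable lborel Fh"
  shows "cmod (F s) \<le> (LINT \<xi>|lborel. cmod (Fh \<xi>))"
proof -
  have Fm[measurable]: "F \<in> borel_measurable borel" using int by auto
  have Fhm[measurable]: "Fh \<in> borel_measurable borel" using inth by auto
  have "cmod (LINT u|lborel. complex_of_real (real (Suc n) * std_normal_density (real (Suc n) * (u - s))) * F u) \<le> (LINT \<xi>|lborel. cmod (Fh \<xi>))" (is "cmod ?I \<le> ?R") for n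
  proof -
    define m where "m = real (Suc n)"
    have m: "m > 0" unfolding m_def by simp
    define c where "c = m / sqrt (2 * pi)"
    have c: "c > 0" unfolding c_def using m by simp
    define G where "G u x = F u * (complex_of_real (std_normal_density x) * iexp ((m * (s - u)) * x))" for u x
    have ker: "complex_of_real (m * std_normal_density (m * (u - s))) = of_real c * (LINT x|lborel. complex_of_real (std_normal_density x) * iexp ((m * (s - u)) * x))" for u
      unfolding std_normal_fourier(2) by (simp add: c_def std_normal_density_def power_mult_distrib power2_commute)
    have "?I = (LINT u|lborel. of_real c * (LINT x|lborel. G u x))"
      unfolding m_def[symmetric] ker G_def by (simp add: mult_ac)
    also have "\<dots> = of_real c * (LINT u|lborel. LINT x|lborel. G u x)" by simp
    also have "(LINT u|lborel. LINT x|lborel. G u x) = (LINT x|lborel. LINT u|lborel. G u x)"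
    proof (rule lborel_pair.Fubini_integral[symmetric])
      have gm: "(\<lambda>(u, x). G u x) \<in> borel_measurable (lborel \<Otimes>\<^sub>M lborel)"
        unfolding G_def by measurable
      have "integrable (lborel \<Otimes>\<^sub>M lborel) (\<lambda>z. F (fst z) * complex_of_real (std_normal_density (snd z)))"
        using lborel_pair.Fubini_integrable[of "\<lambda>z. F (fst z) * complex_of_real (std_normal_density (snd z))"] int
        by (simp add: norm_mult)
      then show "integrable (lborel \<Otimes>\<^sub>M lborel) (\<lambda>(u, x). G u x)"
        by (rule Bochner_Integration.integrable_bound) (use gm in \<open>auto simp: G_def norm_mult\<close>)
    qed
    also have "(\<lambda>x. LINT u|lborel. G u x) = (\<lambda>x. complex_of_real (std_normal_density x) * iexp (m * s * x) * Fh (m / (2*pi) * x))"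
    proof
      fix x
      have "G u x = complex_of_real (std_normal_density x) * iexp (m * s * x) * (F u * iexp (- (2 * pi * (m / (2*pi) * x) * u)))" for u
      proof -
        have "iexp ((m * (s - u)) * x) = iexp (m * s * x) * iexp (- (2 * pi * (m / (2*pi) * x) * u))"
          unfolding exp_add[symmetric] by (simp add: algebra_simps)
        then show ?thesis unfolding G_def by simp
      qed
      then show "(LINT u|lborel. G u x) = complex_of_real (std_normal_density x) * iexp (m * s * x) * Fh (m / (2*pi) * x)"
        unfolding hat by simp
    qed
    finally have I: "?I = of_real c * (LINT x|lborel. complex_of_real (std_normal_density x) * iexp (m * s * x) * Fh (m / (2*pi) * x))" .
    have ia: "integrable lborel (\<lambda>x. Fh (m / (2*pi) * x))"
      using lborel_integrable_real_affine[OF inth, of "m/(2*pi)" 0] m by simp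
    have db: "std_normal_density x \<le> 1 / sqrt (2*pi)" for x
      unfolding std_normal_density_def by (simp add: divide_simps)
    have "cmod (LINT x|lborel. complex_of_real (std_normal_density x) * iexp (m * s * x) * Fh (m / (2*pi) * x)) \<le> (LINT x|lborel. (1 / sqrt (2*pi)) * cmod (Fh (m / (2*pi) * x)))"
    proof (rule Bochner_Integration.integral_norm_bound_integral)
      show "integrable lborel (\<lambda>x. (1 / sqrt (2*pi)) * cmod (Fh (m / (2*pi) * x)))" using ia by simp
      show n: "norm (complex_of_real (std_normal_density x) * iexp (m * s * x) * Fh (m / (2*pi) * x)) \<le> (1 / sqrt (2*pi)) * cmod (Fh (m / (2*pi) * x))" for x
        using mult_right_mono[OF db[of x] norm_ge_zero[of "Fh (m / (2*pi) * x)"]] by (simp add: norm_mult)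
      show "integrable lborel (\<lambda>x. complex_of_real (std_normal_density x) * iexp (m * s * x) * Fh (m / (2*pi) * x))"
        by (rule Bochner_Integration.integrable_bound[of _ "\<lambda>x. (1 / sqrt (2*pi)) * cmod (Fh (m / (2*pi) * x))"])
           (use ia n in auto)
    qed
    then have "cmod ?I \<le> c * (LINT x|lborel. (1 / sqrt (2*pi)) * cmod (Fh (m / (2*pi) * x)))"
      unfolding I norm_mult using c by (simp only: norm_of_real abs_of_pos mult_left_mono less_imp_le)
    also have "\<dots> = (c / sqrt (2*pi)) * (LINT x|lborel. cmod (Fh (m / (2*pi) * x)))" by simp
    also have "c / sqrt (2*pi) = m / (2*pi)" unfolding c_def by simp
    also have "m / (2*pi) * (LINT x|lborel. cmod (Fh (m / (2*pi) * x))) = ?R"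
      using lborel_integral_real_affine[of "m/(2*pi)" "\<lambda>x. cmod (Fh x)" 0] m by simp
    finally show ?thesis .
  qed
  then show ?thesis
    by (intro tendsto_upperbound[OF tendsto_norm[OF normal_kernel_tendsto[OF cont int]]]) auto
qed


lemma stft_gauss_eq:
  "stft (gauss 1) f (x, \<xi>) = (LINT u|lborel. (f u * gauss 1 (u - x)) * iexp (- (2 * pi * \<xi> * u)))"
  unfolding stft_def L2_inner_def tf_shift_def modul_def transl_def gauss_def
  by (intro Bochner_Integration.integral_cong refl) (simp add: exp_cnj mult_ac)

lemma gauss_shift_integrable: "integrable lborel (\<lambda>u. exp (- (pi * (u - x)\<^sup>2)))"
proof -
  have "integrable lborel (\<lambda>u. std_normal_density (- sqrt (2*pi) * x + sqrt (2*pi) * u))"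
    by (rule lborel_integrable_real_affine) auto
  then have "integrable lborel (\<lambda>u. sqrt (2*pi) * std_normal_density (- sqrt (2*pi) * x + sqrt (2*pi) * u))"
    by (rule integrable_mult_right)
  moreover have "sqrt (2*pi) * std_normal_density (- sqrt (2*pi) * x + sqrt (2*pi) * u) = exp (- (pi * (u - x)\<^sup>2))" for u
  proof -
    have "- sqrt (2*pi) * x + sqrt (2*pi) * u = sqrt (2*pi) * (u - x)" by (simp add: algebra_simps)
    then show ?thesis unfolding std_normal_density_def by (simp add: power_mult_distrib)
  qed
  ultimately show ?thesis by (simp only:)
qed

lemma L2_window_integrable:
  assumes "f \<in> L2_fun" shows "integrable lborel (\<lambda>u. f u * gauss 1 (u - x))"
proof (rule Bochner_Integration.integrable_bound)
  have [measurable]: "f \<in> borel_measurable borel" using assms by (simp add: L2_fun_def)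
  show "integrable lborel (\<lambda>u. (cmod (f u))\<^sup>2 + exp (- (pi * (u - x)\<^sup>2)))"
    using assms gauss_shift_integrable[of x] by (auto simp: L2_fun_def)
  show "(\<lambda>u. f u * gauss 1 (u - x)) \<in> borel_measurable lborel" unfolding gauss_def by measurable
  have "norm (f u * gauss 1 (u - x)) \<le> norm ((cmod (f u))\<^sup>2 + exp (- (pi * (u - x)\<^sup>2)))" for u
  proof -
    define a b where "a = cmod (f u)" and "b = exp (- (pi * (u - x)\<^sup>2))"
    have ab: "0 \<le> a" "0 \<le> b" "b \<le> 1" unfolding a_def b_def by auto
    have "0 \<le> (a - b)\<^sup>2" by simp
    then have "2 * (a * b) \<le> a\<^sup>2 + b\<^sup>2" by (simp add: power2_diff)
    moreover have "b\<^sup>2 \<le> b" using ab by (simp add: power2_eq_square mult_left_le)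
    moreover have "0 \<le> a * b" using ab by simp
    ultimately have "a * b \<le> a\<^sup>2 + b" by linarith
    then show ?thesis using ab by (simp add: norm_mult gauss_def a_def b_def)
  qed
  then show "AE u in lborel. norm (f u * gauss 1 (u - x)) \<le> norm ((cmod (f u))\<^sup>2 + exp (- (pi * (u - x)\<^sup>2)))" by simp
qed

lemma S0_sample_sum_le:
  assumes g: "g \<in> S0" and F: "finite (F :: int set)"
  shows "(\<Sum>k\<in>F. cmod (g (t + of_int k))) \<le> exp pi * S0_norm g"
proof -
  define V where "V = stft (gauss 1) g"
  define A where "A x = (LINT \<xi>|lborel. cmod (V (x, \<xi>)))" for x
  have L2: "g \<in> L2_fun" and cont: "continuous_on UNIV g" and V: "integrable (lborel \<Otimes>\<^sub>M lborel) V"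
    using g by (auto simp: S0_def V_def lborel_prod)
  have Vn: "integrable (lborel \<Otimes>\<^sub>M lborel) (\<lambda>(x,\<xi>). cmod (V (x, \<xi>)))"
    using integrable_norm[OF V] by (simp add: case_prod_unfold)
  have A: "integrable lborel A" unfolding A_def using lborel_pair.integrable_fst[OF Vn] .
  have SA: "S0_norm g = (LINT x|lborel. A x)"
    using lborel_pair.integral_fst[OF Vn] by (simp add: S0_norm_def A_def V_def lborel_prod case_prod_unfold)
  have A0: "A x \<ge> 0" for x unfolding A_def by simp
  have pt: "AE x in lborel. \<forall>s. cmod (g s) * exp (- (pi * (s - x)\<^sup>2)) \<le> A x"
  proof -
    have "AE x in lborel. integrable lborel (\<lambda>\<xi>. V (x, \<xi>))" using lborel_pair.AE_integrable_fst'[OF V] .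
    then show ?thesis
    proof eventually_elim
      case (elim x)
      show ?case
      proof
        fix s
        have "continuous_on UNIV (\<lambda>u. g u * gauss 1 (u - x))" unfolding gauss_def
          by (intro continuous_intros cont)
        then have "cmod (g s * gauss 1 (s - x)) \<le> (LINT \<xi>|lborel. cmod (V (x, \<xi>)))"
          by (rule norm_le_fourier_L1[OF _ L2_window_integrable[OF L2] _ elim])
             (simp only: V_def stft_gauss_eq)
        then show "cmod (g s) * exp (- (pi * (s - x)\<^sup>2)) \<le> A x"
          by (simp add: A_def norm_mult gauss_def)
      qed
    qed
  qed
  let ?J = "\<lambda>k::int. {t + of_int k..<t + of_int k + 1}"
  have each: "exp (- pi) * cmod (g (t + of_int k)) \<le> (LINT x|lborel. indicator (?J k) x *\<^sub>R A x)" for k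
  proof -
    have "exp (- pi) * cmod (g (t + of_int k)) = (LINT x|lborel. indicator (?J k) x *\<^sub>R (exp (- pi) * cmod (g (t + of_int k))))"
      by simp
    also have "\<dots> \<le> (LINT x|lborel. indicator (?J k) x *\<^sub>R A x)"
    proof (rule integral_mono_AE)
      show "integrable lborel (\<lambda>x. indicator (?J k) x *\<^sub>R (exp (- pi) * cmod (g (t + of_int k))))" by simp
      show "integrable lborel (\<lambda>x. indicator (?J k) x *\<^sub>R A x)"
        by (intro integrable_mult_indicator A) simp
      show "AE x in lborel. indicator (?J k) x *\<^sub>R (exp (- pi) * cmod (g (t + of_int k))) \<le> indicator (?J k) x *\<^sub>R A x"
        using pt
      proof eventually_elim
        case (elim x)
        show ?case
        proof (cases "x \<in> ?J k")
          case True
          then have "\<bar>t + of_int k - x\<bar> \<le> 1" by auto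
          then have "(t + of_int k - x)\<^sup>2 \<le> 1" using power_mono[of "\<bar>t + of_int k - x\<bar>" 1 2] by simp
          then have "pi * (t + of_int k - x)\<^sup>2 \<le> pi * 1" by (intro mult_left_mono) auto
          then have "exp (- pi) * cmod (g (t + of_int k)) \<le> exp (- (pi * (t + of_int k - x)\<^sup>2)) * cmod (g (t + of_int k))"
            by (intro mult_right_mono) auto
          also have "\<dots> \<le> A x" using elim by (simp add: mult.commute)
          finally show ?thesis using True by simp
        qed simp
      qed
    qed
    finally show ?thesis .
  qed
  have intJ: "integrable lborel (\<lambda>x. indicator (?J k) x *\<^sub>R A x)" for k
    by (intro integrable_mult_indicator A) simp
  have "exp (- pi) * (\<Sum>k\<in>F. cmod (g (t + of_int k))) \<le> (\<Sum>k\<in>F. LINT x|lborel. indicator (?J k) x *\<^sub>R A x)"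
    unfolding sum_distrib_left by (intro sum_mono each)
  also have "\<dots> = (LINT x|lborel. (\<Sum>k\<in>F. indicator (?J k) x *\<^sub>R A x))"
    by (rule Bochner_Integration.integral_sum[symmetric]) (rule intJ)
  also have "\<dots> \<le> (LINT x|lborel. A x)"
  proof (rule integral_mono[OF _ A])
    show "integrable lborel (\<lambda>x. \<Sum>k\<in>F. indicator (?J k) x *\<^sub>R A x)"
      by (rule Bochner_Integration.integrable_sum) (rule intJ)
    fix x
    have "indicator (?J k) x *\<^sub>R A x = (if k = \<lfloor>x - t\<rfloor> then A x else 0)" for k
    proof -
      have "x \<in> ?J k \<longleftrightarrow> \<lfloor>x - t\<rfloor> = k" unfolding floor_eq_iff by auto
      then show ?thesis by auto
    qed
    then show "(\<Sum>k\<in>F. indicator (?J k) x *\<^sub>R A x) \<le> A x" using F A0[of x] by (simp add: sum.delta')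
  qed
  finally have "exp (- pi) * (\<Sum>k\<in>F. cmod (g (t + of_int k))) \<le> S0_norm g" unfolding SA .
  then have "exp pi * (exp (- pi) * (\<Sum>k\<in>F. cmod (g (t + of_int k)))) \<le> exp pi * S0_norm g"
    by (intro mult_left_mono) auto
  then show ?thesis by (simp add: exp_minus mult.assoc[symmetric])
qed

lemma S0_samples_abs_summable:
  assumes "g \<in> S0" shows "(\<lambda>k::int. cmod (cnj (g (t + of_int k)))) summable_on UNIV"
  unfolding Infinite_Sum.abs_summable_iff_bdd_above
  by (rule bdd_aboveI[of _ "exp pi * S0_norm g"]) (auto intro: S0_sample_sum_le[OF assms])

lemma S0_add:
  assumes f: "f \<in> S0" and g: "g \<in> S0" shows "(\<lambda>t. f t + g t) \<in> S0"
proof -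
  have L2: "f \<in> L2_fun" "g \<in> L2_fun" using f g by (auto simp: S0_def)
  have [measurable]: "f \<in> borel_measurable borel" "g \<in> borel_measurable borel" using L2 by (auto simp: L2_fun_def)
  have "integrable lborel (\<lambda>t. (cmod (f t + g t))\<^sup>2)"
  proof (rule Bochner_Integration.integrable_bound)
    show "integrable lborel (\<lambda>t. 2 * (cmod (f t))\<^sup>2 + 2 * (cmod (g t))\<^sup>2)"
      using L2 by (auto simp: L2_fun_def)
    have "(cmod (f t + g t))\<^sup>2 \<le> 2 * (cmod (f t))\<^sup>2 + 2 * (cmod (g t))\<^sup>2" for t
    proof -
      have "(cmod (f t + g t))\<^sup>2 \<le> (cmod (f t) + cmod (g t))\<^sup>2" by (intro power_mono norm_triangle_ineq) simp
      moreover have "0 \<le> (cmod (f t) - cmod (g t))\<^sup>2" by simp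
      ultimately show ?thesis by (simp add: power2_sum power2_diff)
    qed
    then show "AE t in lborel. norm ((cmod (f t + g t))\<^sup>2) \<le> norm (2 * (cmod (f t))\<^sup>2 + 2 * (cmod (g t))\<^sup>2)" by simp
  qed measurable
  then have "(\<lambda>t. f t + g t) \<in> L2_fun" by (simp add: L2_fun_def)
  moreover have "continuous_on UNIV (\<lambda>t. f t + g t)" using f g by (auto simp: S0_def intro: continuous_on_add)
  moreover have "stft (gauss 1) (\<lambda>t. f t + g t) = (\<lambda>z. stft (gauss 1) f z + stft (gauss 1) g z)"
  proof
    fix z :: "real \<times> real"
    obtain x \<xi> where z: "z = (x, \<xi>)" by (cases z)
    have i: "integrable lborel (\<lambda>u. (h u * gauss 1 (u - x)) * iexp (- (2 * pi * \<xi> * u)))" if "h \<in> L2_fun" for h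
    proof (rule Bochner_Integration.integrable_bound[OF L2_window_integrable[OF that, of x]])
      have [measurable]: "h \<in> borel_measurable borel" using that by (auto simp: L2_fun_def)
      show "(\<lambda>u. (h u * gauss 1 (u - x)) * iexp (- (2 * pi * \<xi> * u))) \<in> borel_measurable lborel"
        unfolding gauss_def by measurable
    qed (simp add: norm_mult)
    show "stft (gauss 1) (\<lambda>t. f t + g t) z = stft (gauss 1) f z + stft (gauss 1) g z"
      unfolding z stft_gauss_eq by (subst Bochner_Integration.integral_add[symmetric, OF i[OF L2(1)] i[OF L2(2)]]) (simp add: algebra_simps)
  qed
  ultimately show ?thesis using f g by (simp add: S0_def)
qed

lemma S0_cmult:
  assumes f: "f \<in> S0" shows "(\<lambda>t. c * f t) \<in> S0"
proof -
  have "stft (gauss 1) (\<lambda>t. c * f t) = (\<lambda>z. c * stft (gauss 1) f z)"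
    by (simp add: stft_def L2_inner_def mult.assoc fun_eq_iff)
  then show ?thesis using f
    by (auto simp: S0_def L2_fun_def norm_mult power_mult_distrib intro: continuous_on_mult_left)
qed

lemma delta_train_S0:
  "g \<in> S0 \<Longrightarrow> delta_train N n g = (\<Sum>\<^sub>\<infinity>k\<in>(UNIV :: int set). cnj (g (real n / real N + of_int k)))"
  by (simp add: delta_train_def delta_def)

lemma delta_train_add:
  "f \<in> S0 \<Longrightarrow> g \<in> S0 \<Longrightarrow> delta_train N n (\<lambda>t. f t + g t) = delta_train N n f + delta_train N n g"
  using infsum_add[OF Infinite_Sum.abs_summable_summable[OF S0_samples_abs_summable[of f "real n / real N"]]
      Infinite_Sum.abs_summable_summable[OF S0_samples_abs_summable[of g "real n / real N"]]]
  by (simp add: delta_train_S0 S0_add del: infsum_cnj)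

lemma delta_train_cmult:
  "f \<in> S0 \<Longrightarrow> delta_train N n (\<lambda>t. c * f t) = cnj c * delta_train N n f"
  by (simp add: delta_train_S0 S0_cmult infsum_cmult_right')

lemma delta_train_bound:
  assumes g: "g \<in> S0" shows "cmod (delta_train N n g) \<le> exp pi * S0_norm g"
proof -
  have "cmod (delta_train N n g) \<le> (\<Sum>\<^sub>\<infinity>k\<in>(UNIV :: int set). cmod (cnj (g (real n / real N + of_int k))))"
    unfolding delta_train_S0[OF g] by (rule norm_infsum_bound) (rule S0_samples_abs_summable[OF g])
  also have "\<dots> \<le> exp pi * S0_norm g"
    using S0_samples_abs_summable[OF g] S0_sample_sum_le[OF g] by (intro infsum_le_finite_sums) auto
  finally show ?thesis .
qed

lemma delta_train_in_S0_dual: "delta_train N n \<in> S0_dual"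
  unfolding S0_dual_def
  by (auto simp: delta_train_add delta_train_cmult delta_train_bound intro!: exI[of _ "exp pi"])
     (simp add: delta_train_def delta_def)

lemma SN_subset_S0_dual: "SN N \<subseteq> S0_dual"
proof
  fix \<phi> assume "\<phi> \<in> SN N"
  then obtain a where \<phi>: "\<phi> = (\<lambda>g. \<Sum>n<N. a n * delta_train N n g)" by (auto simp: SN_def train_comb_def)
  have "\<exists>C. \<forall>f\<in>S0. cmod (\<phi> f) \<le> C * S0_norm f"
  proof (intro exI ballI)
    fix f assume that: "f \<in> S0"
    show "cmod (\<phi> f) \<le> (\<Sum>n<N. cmod (a n) * exp pi) * S0_norm f"
    unfolding \<phi> sum_distrib_right
    by (rule order_trans[OF norm_sum]) (auto simp: norm_mult mult.assoc intro!: sum_mono mult_left_mono delta_train_bound that)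
  qed
  moreover have "\<phi> f = 0" if "f \<notin> S0" for f
    unfolding \<phi> by (simp add: delta_train_def delta_def that)
  ultimately show "\<phi> \<in> S0_dual"
    unfolding S0_dual_def
    by (simp add: \<phi> delta_train_add delta_train_cmult algebra_simps sum.distrib sum_distrib_left)
qed

end

theory Submission
  imports Defs "HOL-Complex_Analysis.Complex_Analysis"
begin

text \<open>
  Pairing \<open>\<phi> = \<Sum>n. a n \<epsilon>\<^sub>n\<close> with a time-frequency shifted Gaussian and expanding the square gives
  \<open>V \<phi>(x, \<xi>) = exp (- \<pi> \<lambda> x\<^sup>2) G(u)\<close> with \<open>u = exp (2\<pi>(\<lambda>x - \<i>\<xi>)/N)\<close> and the Laurent series
  \<open>G(u) = \<Sum>m. a(m mod N) exp (- \<pi> \<lambda> (m/N)\<^sup>2) u\<^sup>m\<close>.  The map \<open>(x, \<xi>) \<mapsto> u\<close> identifies the torus with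
  the elliptic curve \<open>\<complex>\<^sup>* / q\<^sup>\<int>\<close>, where \<open>q = exp (- 2\<pi>\<lambda>/N)\<close>.  The special form of the coefficients of
  \<open>G\<close> says exactly that \<open>G(q u) = \<kappa> u\<^sup>-\<^sup>N G(u)\<close> with \<open>\<kappa> = exp (\<pi>\<lambda>)\<close>, so the functions \<open>G\<close> are the theta
  functions of degree \<open>N\<close> with multiplier \<open>\<kappa>\<close>.  The question becomes which \<open>K\<close> points can be common zeros of
  a nonzero theta function of degree \<open>N\<close>; by compactness of the unit sphere of \<open>\<complex>\<^sup>N\<close> the frame
  inequalities hold if and only if there is none (\<open>gives_frame_iff\<close>).

  The answer is Abel's theorem on this curve.  The function \<open>\<theta>(u) = (u; q) (q/u; q)\<close>, built from
  the infinite \<open>q\<close>-Pochhammer symbol, has simple zeros exactly at the powers of \<open>q\<close> and satisfies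
  \<open>\<theta>(q u) = - \<theta>(u)/u\<close>.  If \<open>G \<noteq> 0\<close> vanishes at \<open>N\<close> points \<open>u\<^sub>k\<close> that are distinct on the curve, then
  \<open>H = G / \<Prod>k. \<theta>(u/u\<^sub>k)\<close> is holomorphic on the punctured plane and \<open>H(q u) = c H(u)\<close> for a constant \<open>c\<close>.
  Such a function is a monomial \<open>h u\<^sup>j\<close>, and then \<open>c = q\<^sup>j\<close>.  Hence \<open>G\<close> has no further zeros, and
  \<open>\<kappa> = (-1)\<^sup>N (\<Prod>k. u\<^sub>k) q\<^sup>j\<close> (\<open>theta_factorization\<close>).  Conversely, whenever that product condition holds,
  \<open>u\<^sup>j \<Prod>k. \<theta>(u/u\<^sub>k)\<close> has the right multiplier, and its Laurent coefficients come from some \<open>a \<noteq> 0\<close>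
  (\<open>theta_product_laurent\<close>, \<open>train_coeff_surj\<close>).  Taking arguments and absolute values turns the product condition
  into the excluded values of the mean of the points (\<open>tf_point_product_condition\<close>).  For fewer than \<open>N\<close>
  points, extra zeros can be chosen so that the product condition holds, so a frame is
  impossible.
\<close>

section \<open>Laurent series on the punctured plane\<close>

lemma power_series_entire:
  fixes a :: "nat \<Rightarrow> complex"
  assumes "\<And>w. (\<lambda>n. a n * w ^ n) sums f w"
  shows "f holomorphic_on UNIV"
proof -
  have "f field_differentiable at x" for x
  proof -
    have "f holomorphic_on ball 0 (norm x + 1)"
      using power_series_holomorphic[of 0 "norm x + 1" a f] assms by simp
    then show ?thesis
      by (rule holomorphic_on_imp_differentiable_at) auto
  qed
  then show ?thesis by (simp add: holomorphic_on_def field_differentiable_at_within)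
qed

text \<open>
  The nonnegative and the negative powers are separate power series, in \<open>u\<close> and in \<open>1/u\<close>, and
  both converge everywhere.  This makes \<open>F\<close> holomorphic and lets Liouville's theorem act on the parts.
\<close>

lemma laurent_split:
  fixes c :: "int \<Rightarrow> complex"
  assumes F: "\<And>u. u \<noteq> 0 \<Longrightarrow> ((\<lambda>m. c m * u powi m) has_sum F u) UNIV"
  obtains f g where "f holomorphic_on UNIV" "g holomorphic_on UNIV" "f 0 = c 0" "g 0 = 0"
    "\<And>u. u \<noteq> 0 \<Longrightarrow> F u = f u + g (1 / u)"
proof -
  let ?P = "range int" and ?M = "(\<lambda>n. - int (Suc n)) ` UNIV"
  have un: "(UNIV :: int set) = ?P \<union> ?M"
  proof -
    have "m \<in> ?P \<union> ?M" for m :: int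
      by (cases m) auto
    then show ?thesis by blast
  qed
  have dj: "?P \<inter> ?M = {}" by auto
  have inj: "inj int" "inj (\<lambda>n. - int (Suc n))" by (auto simp: inj_def)
  define f where "f u = (\<Sum>n. c (int n) * u ^ n)" for u
  define h where "h v = (\<Sum>n. c (- int (Suc n)) * v ^ n)" for v
  have P: "((\<lambda>n. c (int n) * u ^ n) has_sum f u) UNIV" if "u \<noteq> 0" for u
  proof -
    have "(\<lambda>m. c m * u powi m) summable_on ?P"
      by (rule summable_on_subset[OF has_sum_imp_summable[OF F[OF that]]]) simp
    then have s: "(\<lambda>n. c (int n) * u ^ n) summable_on UNIV"
      unfolding summable_on_reindex[OF inj(1)] by (simp add: o_def)
    show ?thesis
      using has_sum_infsum[OF s] has_sum_imp_sums[OF has_sum_infsum[OF s]] by (simp add: f_def sums_iff)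
  qed
  have M: "((\<lambda>n. c (- int (Suc n)) * v ^ n) has_sum h v) UNIV"
    and M': "((\<lambda>n. c (- int (Suc n)) * (1/v) powi (- int (Suc n))) has_sum v * h v) UNIV" if "v \<noteq> 0" for v
  proof -
    have e: "(1/v) powi (- int (Suc n)) = v * v ^ n" for n
      by (simp add: power_int_minus power_int_divide_distrib field_simps del: of_nat_Suc)
    have "(\<lambda>m. c m * (1/v) powi m) summable_on ?M"
      by (rule summable_on_subset[OF has_sum_imp_summable[OF F]]) (use that in auto)
    then have "(\<lambda>n. v * (c (- int (Suc n)) * v ^ n)) summable_on UNIV"
      unfolding summable_on_reindex[OF inj(2)] o_def e by (simp add: mult_ac)
    then have s: "(\<lambda>n. c (- int (Suc n)) * v ^ n) summable_on UNIV"
      by (simp add: summable_on_cmult_right' that)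
    show 1: "((\<lambda>n. c (- int (Suc n)) * v ^ n) has_sum h v) UNIV"
      using has_sum_infsum[OF s] has_sum_imp_sums[OF has_sum_infsum[OF s]] by (simp add: h_def sums_iff)
    show "((\<lambda>n. c (- int (Suc n)) * (1/v) powi (- int (Suc n))) has_sum v * h v) UNIV"
      using has_sum_cmult_right[OF 1, of v] unfolding e by (simp add: mult_ac)
  qed
  have f: "f holomorphic_on UNIV"
  proof (rule power_series_entire)
    fix w show "(\<lambda>n. c (int n) * w ^ n) sums f w"
      using P[of w, THEN has_sum_imp_sums] powser_sums_zero[of "\<lambda>n. c (int n)"] suminf_zero powser_zero
      by (cases "w = 0") (auto simp: f_def)
  qed
  have h: "h holomorphic_on UNIV"
  proof (rule power_series_entire)
    fix w show "(\<lambda>n. c (- int (Suc n)) * w ^ n) sums h w"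
      using M[of w, THEN has_sum_imp_sums] powser_sums_zero[of "\<lambda>n. c (- int (Suc n))"] powser_zero
      by (cases "w = 0") (auto simp: h_def simp del: of_nat_Suc)
  qed
  show thesis
  proof (rule that[of f "\<lambda>v. v * h v"])
    show "f 0 = c 0" unfolding f_def using powser_zero[of "\<lambda>n. c (int n)"] by simp
    fix u :: complex assume u: "u \<noteq> 0"
    have "((\<lambda>m. c m * u powi m) has_sum f u) ?P"
      unfolding has_sum_reindex[OF inj(1)] using P[OF u] by (simp add: o_def)
    moreover have "((\<lambda>m. c m * u powi m) has_sum (1/u) * h (1/u)) ?M"
      unfolding has_sum_reindex[OF inj(2)] using M'[of "1/u"] u by (simp add: o_def)
    ultimately have "((\<lambda>m. c m * u powi m) has_sum (f u + (1/u) * h (1/u))) UNIV"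
      unfolding un by (rule has_sum_Un_disjoint[OF _ _ dj])
    then show "F u = f u + (1/u) * h (1/u)" using F[OF u] by (rule has_sum_unique[OF _ , symmetric])
  qed (auto intro!: holomorphic_intros f h)
qed

text \<open>
  In a vanishing Laurent series the part with nonnegative powers equals \<open>- g (1/u)\<close>, which tends
  to 0 at infinity; by Liouville's theorem this entire function is 0.
\<close>

lemma laurent_coeff_0_eq_0:
  fixes c :: "int \<Rightarrow> complex"
  assumes F: "\<And>u. u \<noteq> 0 \<Longrightarrow> ((\<lambda>m. c m * u powi m) has_sum 0) UNIV"
  shows "c 0 = 0"
proof -
  obtain f g where fg: "f holomorphic_on UNIV" "g holomorphic_on UNIV" "f 0 = c 0" "g 0 = 0"
    "\<And>u. u \<noteq> 0 \<Longrightarrow> 0 = f u + g (1 / u)"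
    by (rule laurent_split[of c "\<lambda>_. 0"]) (use F in auto)
  have "isCont g 0"
    by (rule field_differentiable_imp_continuous_at, rule holomorphic_on_imp_differentiable_at[OF fg(2)]) auto
  then have "((\<lambda>u. - g (1 / u)) \<longlongrightarrow> 0) at_infinity"
    using tendsto_minus[OF isCont_tendsto_compose[OF \<open>isCont g 0\<close> tendsto_inverse_0]] fg(4)
    by (simp add: inverse_eq_divide)
  moreover have "eventually (\<lambda>u. - g (1 / u) = f u) at_infinity"
    unfolding eventually_at_infinity
  proof (intro exI[of _ 1] allI impI)
    fix u :: complex assume "1 \<le> norm u"
    then have "u \<noteq> 0" by auto
    then show "- g (1 / u) = f u" using fg(5)[of u] by (simp add: neg_eq_iff_add_eq_0 add.commute)
  qed
  ultimately have "(f \<longlongrightarrow> 0) at_infinity" by (rule Lim_transform_eventually)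
  then show ?thesis using Liouville_weak_0[OF fg(1)] fg(3) by metis
qed

text \<open>
  Multiplying by \<open>u\<close> to the power \<open>-k\<close> moves every coefficient to index 0.
\<close>

lemma laurent_coeffs_unique:
  fixes c d :: "int \<Rightarrow> complex"
  assumes c: "\<And>u. u \<noteq> 0 \<Longrightarrow> ((\<lambda>m. c m * u powi m) has_sum F u) UNIV"
    and d: "\<And>u. u \<noteq> 0 \<Longrightarrow> ((\<lambda>m. d m * u powi m) has_sum F u) UNIV"
  shows "c = d"
proof
  fix k
  have "c (0 + k) - d (0 + k) = 0"
  proof (rule laurent_coeff_0_eq_0[of "\<lambda>m. c (m + k) - d (m + k)"])
    fix u :: complex assume u: "u \<noteq> 0"
    have "((\<lambda>m. u powi (- k) * (c m * u powi m + - (d m * u powi m))) has_sum u powi (- k) * (F u + - F u)) UNIV"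
      by (intro has_sum_cmult_right has_sum_add has_sum_uminusI c d u)
    then have "((\<lambda>m. (c m - d m) * u powi (m - k)) has_sum 0) UNIV"
      using u by (simp add: algebra_simps power_int_add power_int_diff power_int_minus divide_inverse)
    then show "((\<lambda>m. (c (m + k) - d (m + k)) * u powi m) has_sum 0) UNIV"
      by (rule has_sum_reindex_bij_witness[THEN iffD1, of UNIV "\<lambda>m. m + k" "\<lambda>m. m - k", rotated 6]) auto
  qed
  then show "c k = d k" by simp
qed

lemma entire_has_sum:
  assumes "f holomorphic_on UNIV"
  obtains a where "\<And>w. ((\<lambda>n. a n * w ^ n) has_sum f w) UNIV" "\<And>w. (\<lambda>n. norm (a n * w ^ n)) summable_on (UNIV :: nat set)"
proof -
  define a where "a n = (deriv ^^ n) f 0 / fact n" for n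
  have s: "(\<lambda>n. a n * w ^ n) sums f w" for w
    using holomorphic_power_series[of f 0 "norm w + 1" w] holomorphic_on_subset[OF assms]
    by (simp add: a_def)
  have ab: "summable (\<lambda>n. norm (a n * w ^ n))" for w
    by (rule powser_insidea[of a "of_real (norm w + 1)"]) (use s sums_iff in \<open>auto simp: sums_iff\<close>)
  show thesis
    by (rule that[of a]) (auto intro!: norm_summable_imp_has_sum ab s norm_summable_imp_summable_on simp: )
qed

text \<open>
  The coefficients are those of the Cauchy product: the absolutely convergent double series
  of \<open>f u * g (1/u)\<close> is grouped along the lines of constant total exponent.
\<close>

lemma laurent_exists:
  assumes "f holomorphic_on UNIV" "g holomorphic_on UNIV"
  obtains c :: "int \<Rightarrow> complex" where
    "\<And>u. u \<noteq> 0 \<Longrightarrow> ((\<lambda>m. c m * u powi m) has_sum u powi j * (f u * g (1 / u))) UNIV"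
proof -
  obtain a where a: "\<And>w. ((\<lambda>n. a n * w ^ n) has_sum f w) UNIV" "\<And>w. (\<lambda>n. norm (a n * w ^ n)) summable_on (UNIV :: nat set)"
    using entire_has_sum[OF assms(1)] by metis
  obtain b where b: "\<And>w. ((\<lambda>n. b n * w ^ n) has_sum g w) UNIV" "\<And>w. (\<lambda>n. norm (b n * w ^ n)) summable_on (UNIV :: nat set)"
    using entire_has_sum[OF assms(2)] by metis
  define D where "D m = {(i, l). j + int i - int l = m}" for m
  define c where "c m = (\<Sum>\<^sub>\<infinity>(i,l)\<in>D m. a i * b l)" for m
  show thesis
  proof (rule that[of c])
    fix u :: complex assume u: "u \<noteq> 0"
    let ?t = "\<lambda>(i, l). (a i * u ^ i) * (b l * (1/u) ^ l)"
    define t where "t p = (a (fst p) * u ^ fst p) * (b (snd p) * (1/u) ^ snd p)" for p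
    have "(\<lambda>p. norm (t p)) summable_on UNIV \<times> UNIV"
      unfolding Infinite_Sum.abs_summable_on_Sigma_iff
    proof (intro conjI ballI)
      have n: "norm (t (i, l)) = norm (a i * u ^ i) * norm (b l * (1/u) ^ l)" for i l
        unfolding t_def by (simp only: norm_mult fst_conv snd_conv)
      show "(\<lambda>l. norm (t (i, l))) summable_on UNIV" for i
        unfolding n by (intro summable_on_cmult_right b(2))
      have "(\<Sum>\<^sub>\<infinity>l. norm (t (i, l))) = norm (a i * u ^ i) * (\<Sum>\<^sub>\<infinity>l. norm (b l * (1/u) ^ l))" for i
        unfolding n by (rule infsum_cmult_right')
      then show "(\<lambda>i. norm (\<Sum>\<^sub>\<infinity>l. norm (t (i, l)))) summable_on UNIV"
        by (simp only: real_norm_def abs_mult abs_norm_cancel summable_on_cmult_left a(2))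
    qed
    then have sm: "t summable_on UNIV" by (simp add: abs_summable_summable)
    then obtain S where S: "(t has_sum S) UNIV" by (auto simp: summable_on_def)
    have "((\<lambda>i. a i * u ^ i * g (1/u)) has_sum S) UNIV"
    proof (rule has_sum_SigmaD[where f = t and B = "\<lambda>_. UNIV"])
      show "((\<lambda>l. t (i, l)) has_sum a i * u ^ i * g (1/u)) UNIV" for i
        unfolding t_def fst_conv snd_conv by (rule has_sum_cmult_right[OF b(1)])
    qed (use S in simp)
    then have Seq: "S = f u * g (1/u)"
      by (rule has_sum_unique) (rule has_sum_cmult_left[OF a(1)])
    have tD: "u powi j * t p = a (fst p) * b (snd p) * u powi m" if "p \<in> D m" for p m
    proof -
      have "u powi m = u powi (j + int (fst p) - int (snd p))" using that by (auto simp: D_def)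
      also have "\<dots> = u powi j * u ^ fst p * (1/u) ^ snd p"
        using u by (simp add: power_int_add power_int_diff divide_inverse power_inverse)
      finally show ?thesis by (simp add: t_def)
    qed
    have "((\<lambda>p. u powi j * t p) has_sum u powi j * (f u * g (1/u))) UNIV"
      using has_sum_cmult_right[OF S] Seq by simp
    then have "((\<lambda>(m, p). u powi j * t p) has_sum u powi j * (f u * g (1/u))) (Sigma UNIV D)"
      by (rule has_sum_reindex_bij_witness[THEN iffD1, of UNIV snd "\<lambda>p. (j + int (fst p) - int (snd p), p)", rotated 6])
         (auto simp: D_def)
    then show "((\<lambda>m. c m * u powi m) has_sum u powi j * (f u * g (1 / u))) UNIV"
    proof (rule has_sum_SigmaD)
      fix m :: int
      have "(\<lambda>p. u powi j * t p) summable_on D m"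
        by (rule summable_on_subset[OF summable_on_cmult_right[OF sm]]) simp
      then have "(\<lambda>p. (a (fst p) * b (snd p)) * u powi m) summable_on D m"
        by (rule summable_on_cong[THEN iffD1, rotated]) (rule tD)
      then have "(\<lambda>p. a (fst p) * b (snd p)) summable_on D m"
        using u by (simp add: summable_on_cmult_left')
      then have "((\<lambda>p. (a (fst p) * b (snd p)) * u powi m) has_sum c m * u powi m) (D m)"
        by (intro has_sum_cmult_left) (auto simp: c_def case_prod_unfold)
      then show "((\<lambda>y. case (m, y) of (m, p) \<Rightarrow> u powi j * t p) has_sum c m * u powi m) (D m)"
        by (rule has_sum_cong[THEN iffD1, rotated]) (simp add: tD)
    qed
  qed
qed
section \<open>A theta function with prescribed zeros\<close>

text \<open>
  Euler's expansion of the infinite product \<open>\<Prod>i. 1 - q\<^sup>i u\<close>.  Starting from the power series gives an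
  entire function at once, and the functional equation \<open>qpoch_rec\<close> replaces the product.
\<close>

definition qpoch_coeff :: "complex \<Rightarrow> nat \<Rightarrow> complex" where
  "qpoch_coeff q n = (\<Prod>i<n. - (q ^ i) / (1 - q ^ Suc i))"

definition qpoch :: "complex \<Rightarrow> complex \<Rightarrow> complex" where
  "qpoch q u = (\<Sum>n. qpoch_coeff q n * u ^ n)"

definition qtheta :: "complex \<Rightarrow> complex \<Rightarrow> complex" where
  "qtheta q u = qpoch q u * qpoch q (q / u)"

context
  fixes q :: complex
  assumes q: "q \<noteq> 0" "norm q < 1"
begin

lemma one_minus_power_nz: "1 - q ^ Suc n \<noteq> 0"
proof
  assume "1 - q ^ Suc n = 0"
  then have "norm (q ^ Suc n) = 1" by (metis eq_iff_diff_eq_0 norm_one)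
  moreover have "norm q ^ Suc n < 1" using q power_Suc_less_one[of "norm q" n] by simp
  ultimately show False by (simp add: norm_power del: power_Suc)
qed

lemma qpoch_coeff_Suc: "qpoch_coeff q (Suc n) * (1 - q ^ Suc n) = - (qpoch_coeff q n * q ^ n)"
  using one_minus_power_nz[of n] by (simp add: qpoch_coeff_def)

lemma qpoch_sums: "(\<lambda>n. qpoch_coeff q n * w ^ n) sums qpoch q w"
proof -
  have "(\<lambda>n. q ^ n * (w / (1 - q * q ^ n))) \<longlonglongrightarrow> 0 * (w / (1 - q * 0))"
    by (intro tendsto_intros LIMSEQ_power_zero q) simp
  then have "eventually (\<lambda>n. norm (q ^ n * (w / (1 - q * q ^ n))) < 1/2) sequentially"
    by (auto dest!: tendstoD[of _ _ _ "1/2"])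
  then obtain N where N: "\<And>n. n \<ge> N \<Longrightarrow> norm (q ^ n * (w / (1 - q * q ^ n))) < 1/2"
    by (auto simp: eventually_sequentially)
  have "summable (\<lambda>n. qpoch_coeff q n * w ^ n)"
  proof (rule summable_ratio_test[of "1/2" N])
    fix n assume "n \<ge> N"
    have "qpoch_coeff q (Suc n) * w ^ Suc n = - ((q ^ n * (w / (1 - q * q ^ n))) * (qpoch_coeff q n * w ^ n))"
      by (simp add: qpoch_coeff_def)
    then have "norm (qpoch_coeff q (Suc n) * w ^ Suc n) = norm (q ^ n * (w / (1 - q * q ^ n))) * norm (qpoch_coeff q n * w ^ n)"
      by (simp only: norm_minus_cancel norm_mult)
    also have "\<dots> \<le> 1/2 * norm (qpoch_coeff q n * w ^ n)"
      using N[OF \<open>n \<ge> N\<close>] by (intro mult_right_mono) auto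
    finally show "norm (qpoch_coeff q (Suc n) * w ^ Suc n) \<le> 1/2 * norm (qpoch_coeff q n * w ^ n)" .
  qed simp
  then show ?thesis by (simp add: qpoch_def summable_sums)
qed

lemma qpoch_holomorphic: "qpoch q holomorphic_on UNIV"
  by (rule power_series_entire[OF qpoch_sums])

lemma qpoch_0: "qpoch q 0 = 1"
  using powser_zero[of "qpoch_coeff q"] by (simp add: qpoch_def qpoch_coeff_def)

lemma qpoch_rec: "qpoch q u = (1 - u) * qpoch q (q * u)"
proof -
  have "(\<lambda>n. qpoch_coeff q n * u ^ n - qpoch_coeff q n * (q * u) ^ n) sums (qpoch q u - qpoch q (q * u))"
    by (intro sums_diff qpoch_sums)
  then have "(\<lambda>n. qpoch_coeff q (Suc n) * u ^ Suc n - qpoch_coeff q (Suc n) * (q * u) ^ Suc n) sums (qpoch q u - qpoch q (q * u))"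
    by (intro sums_Suc_iff[THEN iffD2]) simp
  moreover have "qpoch_coeff q (Suc n) * u ^ Suc n - qpoch_coeff q (Suc n) * (q * u) ^ Suc n = - u * (qpoch_coeff q n * (q * u) ^ n)" for n
  proof -
    have "qpoch_coeff q (Suc n) * u ^ Suc n - qpoch_coeff q (Suc n) * (q * u) ^ Suc n = (qpoch_coeff q (Suc n) * (1 - q ^ Suc n)) * u ^ Suc n"
      by (simp add: algebra_simps power_mult_distrib)
    then show ?thesis unfolding qpoch_coeff_Suc by (simp add: power_mult_distrib)
  qed
  ultimately have "(\<lambda>n. - u * (qpoch_coeff q n * (q * u) ^ n)) sums (qpoch q u - qpoch q (q * u))"
    by simp
  moreover have "(\<lambda>n. - u * (qpoch_coeff q n * (q * u) ^ n)) sums (- u * qpoch q (q * u))"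
    by (intro sums_mult qpoch_sums)
  ultimately have "qpoch q u - qpoch q (q * u) = - u * qpoch q (q * u)" by (rule sums_unique2)
  then show ?thesis by (simp add: algebra_simps)
qed

lemma qpoch_iter: "qpoch q u = (\<Prod>i<n. 1 - q ^ i * u) * qpoch q (q ^ n * u)"
proof (induction n)
  case (Suc n)
  then show ?case using qpoch_rec[of "q ^ n * u"] by (simp add: mult_ac)
qed simp

text \<open>
  By iterating the recursion, \<open>u\<close> is moved towards 0, where the value is 1; so a zero can only come
  from one of the linear factors that were split off.
\<close>

lemma qpoch_zero_imp:
  assumes "qpoch q u = 0" obtains n where "q ^ n * u = 1"
proof -
  have "isCont (qpoch q) 0"
    by (rule field_differentiable_imp_continuous_at, rule holomorphic_on_imp_differentiable_at[OF qpoch_holomorphic]) auto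
  moreover have "(\<lambda>n. q ^ n * u) \<longlonglongrightarrow> 0" by (rule tendsto_mult_left_zero[OF LIMSEQ_power_zero]) (rule q)
  ultimately have "(\<lambda>n. qpoch q (q ^ n * u)) \<longlonglongrightarrow> qpoch q 0" by (rule isCont_tendsto_compose)
  then have "eventually (\<lambda>n. qpoch q (q ^ n * u) \<noteq> 0) sequentially"
    by (rule tendsto_imp_eventually_ne) (simp add: qpoch_0)
  then obtain n where "qpoch q (q ^ n * u) \<noteq> 0" by (auto simp: eventually_sequentially)
  then have "(\<Prod>i<n. 1 - q ^ i * u) = 0" using qpoch_iter[of u n] assms by simp
  then show thesis using that by auto
qed

lemma qtheta_holomorphic: "qtheta q holomorphic_on -{0}"
  unfolding qtheta_def
  by (intro holomorphic_intros holomorphic_on_compose_gen[OF _ qpoch_holomorphic, unfolded o_def] holomorphic_on_subset[OF qpoch_holomorphic]) auto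

lemma qtheta_shift:
  assumes "u \<noteq> 0" shows "qtheta q (q * u) = - qtheta q u / u"
proof -
  have "qpoch q (1 / u) = (1 - 1 / u) * qpoch q (q / u)" using qpoch_rec[of "1 / u"] by simp
  then have 1: "qtheta q (q * u) = qpoch q (q * u) * ((1 - 1 / u) * qpoch q (q / u))"
    using q by (simp add: qtheta_def)
  have 2: "qtheta q u = (1 - u) * qpoch q (q * u) * qpoch q (q / u)"
    unfolding qtheta_def by (subst qpoch_rec) simp
  show ?thesis unfolding 1 2 using assms by (simp add: field_simps)
qed

lemma qtheta_zero_imp:
  assumes "qtheta q u = 0" "u \<noteq> 0" obtains j where "u = q powi j"
proof -
  consider "qpoch q u = 0" | "qpoch q (q / u) = 0" using assms(1) by (auto simp: qtheta_def)
  then show thesis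
  proof cases
    case 1
    then obtain n where "q ^ n * u = 1" by (rule qpoch_zero_imp)
    then have "u = q powi (- int n)" using q by (simp add: power_int_minus field_simps)
    then show ?thesis by (rule that)
  next
    case 2
    then obtain n where "q ^ n * (q / u) = 1" by (rule qpoch_zero_imp)
    then have "u = q powi (int (Suc n))" using q assms(2) by (simp add: power_int_def nat_add_distrib field_simps)
    then show ?thesis by (rule that)
  qed
qed

text \<open>
  At 1 the simple zero is the visible factor \<open>1 - u\<close>; the quasi-periodicity
  carries it to every power of \<open>q\<close>, in both directions.
\<close>

lemma qtheta_simple_zero:
  "qtheta q (q powi j) = 0 \<and> (\<exists>d. d \<noteq> 0 \<and> (qtheta q has_field_derivative d) (at (q powi j)))"
proof (induction j rule: int_induct[where k = 0])
  case base
  define R where "R u = qpoch q (q * u) * qpoch q (q / u)" for u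
  have "qpoch q q \<noteq> 0"
  proof
    assume "qpoch q q = 0"
    then obtain n where "q ^ n * q = 1" by (rule qpoch_zero_imp)
    then show False using one_minus_power_nz[of n] by (simp add: mult.commute)
  qed
  then have R1: "R 1 \<noteq> 0" by (simp add: R_def)
  have eq: "qtheta q = (\<lambda>u. (1 - u) * R u)"
  proof
    show "qtheta q u = (1 - u) * R u" for u
      unfolding qtheta_def R_def by (subst qpoch_rec[of u]) simp
  qed
  have "R holomorphic_on -{0}" unfolding R_def
    by (intro holomorphic_intros holomorphic_on_compose_gen[OF _ qpoch_holomorphic, unfolded o_def]) auto
  then have "R field_differentiable at 1" by (rule holomorphic_on_imp_differentiable_at) auto
  then obtain R' where "(R has_field_derivative R') (at 1)" by (auto simp: field_differentiable_def)
  moreover have "((\<lambda>u. 1 - u) has_field_derivative -1) (at (1::complex))"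
    by (auto intro!: derivative_eq_intros)
  ultimately have "(qtheta q has_field_derivative - R 1) (at 1)" unfolding eq
    using DERIV_mult[of "\<lambda>u. 1 - u" "-1" 1 UNIV R R'] by simp
  then show ?case using R1 eq by (auto intro!: exI[of _ "- R 1"])
next
  case (step1 j)
  let ?a = "q powi j"
  obtain d where d: "d \<noteq> 0" "(qtheta q has_field_derivative d) (at ?a)" and z: "qtheta q ?a = 0" using step1 by auto
  have qa: "q powi (j + 1) = q * ?a" using q by (simp add: power_int_add mult.commute)
  have a0: "?a \<noteq> 0" using q by simp
  have 1: "((\<lambda>v. v / q) has_field_derivative 1 / q) (at (q * ?a))"
    using q by (auto intro!: derivative_eq_intros)
  have 2: "((\<lambda>v. qtheta q (v / q)) has_field_derivative d * (1 / q)) (at (q * ?a))"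
    by (rule DERIV_chain2[OF _ 1]) (use d q in simp)
  have "((\<lambda>v. - qtheta q (v / q) / (v / q)) has_field_derivative - d / (q * ?a)) (at (q * ?a))"
    by (rule DERIV_cong[OF DERIV_divide[OF DERIV_minus[OF 2] 1]]) (use q a0 z in auto)
  then have "(qtheta q has_field_derivative - d / (q * ?a)) (at (q * ?a))"
  proof (rule has_field_derivative_transform_within_open)
    show "open (-{0::complex})" by auto
    show "- qtheta q (v / q) / (v / q) = qtheta q v" if "v \<in> -{0}" for v
      using qtheta_shift[of "v / q"] that q by simp
  qed (use q a0 in auto)
  moreover have "- d / (q * ?a) \<noteq> 0" using d q a0 by simp
  moreover have "qtheta q (q * ?a) = 0" using qtheta_shift[OF a0] z by simp
  ultimately show ?case unfolding qa by blast
next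
  case (step2 j)
  let ?a = "q powi (j - 1)"
  have qa: "q powi j = q * ?a" using q by (simp add: power_int_diff)
  have a0: "?a \<noteq> 0" using q by simp
  obtain d where d: "d \<noteq> 0" "(qtheta q has_field_derivative d) (at (q * ?a))" and z: "qtheta q (q * ?a) = 0" using step2 qa by auto
  have 1: "((\<lambda>v. q * v) has_field_derivative q) (at ?a)" "((\<lambda>v. - v) has_field_derivative -1) (at ?a)"
    by (auto intro!: derivative_eq_intros)
  have 2: "((\<lambda>v. qtheta q (q * v)) has_field_derivative d * q) (at ?a)"
    by (rule DERIV_chain2[OF d(2) 1(1)])
  have "((\<lambda>v. - v * qtheta q (q * v)) has_field_derivative - ?a * (d * q)) (at ?a)"
    by (rule DERIV_cong[OF DERIV_mult[OF 1(2) 2]]) (use z in auto)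
  then have "(qtheta q has_field_derivative - ?a * (d * q)) (at ?a)"
  proof (rule has_field_derivative_transform_within_open)
    show "open (-{0::complex})" by auto
    show "- v * qtheta q (q * v) = qtheta q v" if "v \<in> -{0}" for v
      using qtheta_shift[of v] that by simp
  qed (use q a0 in auto)
  moreover have "- ?a * (d * q) \<noteq> 0" using d q a0 by simp
  moreover have "qtheta q ?a = 0" using qtheta_shift[OF a0] z a0 q by simp
  ultimately show ?case by blast
qed

end

section \<open>Quasi-periodic functions and their zeros\<close>

text \<open>
  At a zero \<open>a\<close> of the denominator, both functions are divided by \<open>u - a\<close>; the quotient of the two
  results is regular there because the zero of \<open>g\<close> is simple.
\<close>

lemma holomorphic_divide_simple_zeros:
  assumes f: "f holomorphic_on S" and g: "g holomorphic_on S" and S: "open S"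
    and z: "\<And>a. a \<in> S \<Longrightarrow> g a = 0 \<Longrightarrow> f a = 0 \<and> deriv g a \<noteq> 0"
  obtains h where "h holomorphic_on S" "\<And>u. u \<in> S \<Longrightarrow> f u = g u * h u"
proof -
  \<comment> \<open>L'Hopital's rule gives the value at a removable singularity.\<close>
  define h where "h u = (if g u = 0 then deriv f u / deriv g u else f u / g u)" for u
  have "h field_differentiable at a" if a: "a \<in> S" for a
  proof (cases "g a = 0")
    case False
    have o: "open (S \<inter> g -` (-{0}))"
      by (rule continuous_open_preimage[OF holomorphic_on_imp_continuous_on[OF g] S]) auto
    have "h holomorphic_on S \<inter> g -` (-{0})"
      by (rule holomorphic_transform[of "\<lambda>u. f u / g u"])
         (auto simp: h_def intro!: holomorphic_intros holomorphic_on_subset[OF f] holomorphic_on_subset[OF g])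
    then show ?thesis using a False by (intro holomorphic_on_imp_differentiable_at[OF _ o]) auto
  next
    case True
    define f1 g1 where "f1 = (\<lambda>z. if z = a then deriv f a else (f z - f a) / (z - a))"
      and "g1 = (\<lambda>z. if z = a then deriv g a else (g z - g a) / (z - a))"
    have f1: "f1 holomorphic_on S" and g1: "g1 holomorphic_on S"
      unfolding f1_def g1_def using pole_lemma_open[OF f S, of a] pole_lemma_open[OF g S, of a] by auto
    have o: "open (S \<inter> g1 -` (-{0}))"
      by (rule continuous_open_preimage[OF holomorphic_on_imp_continuous_on[OF g1] S]) auto
    have "h holomorphic_on S \<inter> g1 -` (-{0})"
    proof (rule holomorphic_transform[of "\<lambda>u. f1 u / g1 u"])
      show "(\<lambda>u. f1 u / g1 u) holomorphic_on S \<inter> g1 -` (-{0})"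
        by (intro holomorphic_on_divide holomorphic_on_subset[OF f1] holomorphic_on_subset[OF g1]) auto
      show "f1 u / g1 u = h u" if "u \<in> S \<inter> g1 -` (-{0})" for u
        using that z[OF a True] True by (auto simp: h_def f1_def g1_def)
    qed
    moreover have "a \<in> S \<inter> g1 -` (-{0})" using a z[OF a True] by (simp add: g1_def)
    ultimately show ?thesis by (intro holomorphic_on_imp_differentiable_at[OF _ o])
  qed
  then have "h holomorphic_on S" by (simp add: holomorphic_on_def field_differentiable_at_within)
  then show thesis by (rule that) (use z in \<open>auto simp: h_def\<close>)
qed

lemma qtheta_prod_simple_zeros:
  assumes q: "q \<noteq> 0" "norm q < 1" and I: "finite I" and v: "\<And>k. k \<in> I \<Longrightarrow> v k \<noteq> 0"
    and dist: "\<And>i k j. i \<in> I \<Longrightarrow> k \<in> I \<Longrightarrow> i \<noteq> k \<Longrightarrow> v i \<noteq> v k * q powi j"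
    and a: "a \<noteq> 0" "(\<Prod>k\<in>I. qtheta q (a / v k)) = 0"
  obtains k j where "k \<in> I" "a = v k * q powi j" "deriv (\<lambda>u. \<Prod>k\<in>I. qtheta q (u / v k)) a \<noteq> 0"
proof -
  obtain k where k: "k \<in> I" "qtheta q (a / v k) = 0" using a I by auto
  obtain j where j: "a / v k = q powi j" using qtheta_zero_imp[OF q k(2)] a v[OF k(1)] by auto
  then have aj: "a = v k * q powi j" using v[OF k(1)] by (simp add: field_simps)
  define R where "R u = (\<Prod>i\<in>I - {k}. qtheta q (u / v i))" for u
  have Ra: "R a \<noteq> 0"
  proof
    assume "R a = 0"
    then obtain i where i: "i \<in> I" "i \<noteq> k" "qtheta q (a / v i) = 0" using I by (auto simp: R_def)
    obtain l where "a / v i = q powi l" using qtheta_zero_imp[OF q i(3)] a v[OF i(1)] by auto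
    then have "v i * q powi l = v k * q powi j" using aj v[OF i(1)] by (simp add: field_simps)
    then have "v i = v k * q powi (j - l)" using q by (simp add: power_int_diff field_simps)
    then show False using dist[OF i(1) k(1) i(2)] by blast
  qed
  have "R holomorphic_on -{0}" unfolding R_def
    by (intro holomorphic_intros holomorphic_on_compose_gen[OF _ qtheta_holomorphic[OF q], unfolded o_def]) (use v in auto)
  then have "R field_differentiable at a" by (rule holomorphic_on_imp_differentiable_at) (use a in auto)
  then obtain R' where R': "(R has_field_derivative R') (at a)" by (auto simp: field_differentiable_def)
  obtain d where d: "d \<noteq> 0" "(qtheta q has_field_derivative d) (at (a / v k))"
    using qtheta_simple_zero[OF q, of j] j by auto
  have 1: "((\<lambda>u. u / v k) has_field_derivative 1 / v k) (at a)" using v[OF k(1)] by (auto intro!: derivative_eq_intros)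
  have 2: "((\<lambda>u. qtheta q (u / v k)) has_field_derivative d * (1 / v k)) (at a)"
    by (rule DERIV_chain2[OF d(2) 1])
  have "(\<lambda>u. \<Prod>k\<in>I. qtheta q (u / v k)) = (\<lambda>u. qtheta q (u / v k) * R u)"
    using I k(1) by (auto simp: R_def prod.remove)
  moreover have "((\<lambda>u. qtheta q (u / v k) * R u) has_field_derivative d / v k * R a) (at a)"
    by (rule DERIV_cong[OF DERIV_mult[OF 2 R']]) (use k in auto)
  ultimately have "deriv (\<lambda>u. \<Prod>k\<in>I. qtheta q (u / v k)) a = d / v k * R a"
    by (simp add: DERIV_imp_deriv)
  then show thesis using that[OF k(1) aj] d Ra v[OF k(1)] by simp
qed

lemma qtheta_prod_shift:
  assumes "q \<noteq> 0" "norm q < 1" "finite I" "\<And>k. k \<in> I \<Longrightarrow> v k \<noteq> 0" "u \<noteq> 0"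
  shows "(\<Prod>k\<in>I. qtheta q (q * u / v k)) = (-1) ^ card I * (\<Prod>k\<in>I. v k) / u ^ card I * (\<Prod>k\<in>I. qtheta q (u / v k))"
proof -
  have "(\<Prod>k\<in>I. qtheta q (q * u / v k)) = (\<Prod>k\<in>I. (- 1) * v k / u * qtheta q (u / v k))"
  proof (rule prod.cong)
    fix k assume "k \<in> I"
    then show "qtheta q (q * u / v k) = (- 1) * v k / u * qtheta q (u / v k)"
      using qtheta_shift[OF assms(1,2), of "u / v k"] assms(4,5) by simp
  qed simp
  then show ?thesis by (simp only: prod.distrib prod_dividef prod_constant)
qed

text \<open>
  A function on the torus \<open>\<complex>\<^sup>* / q\<^sup>\<int>\<close> with constant multiplier is a monomial.  The multiplier bounds the
  growth at 0 by a power of \<open>u\<close>, so the singularity at 0 is at most a pole and a power of \<open>u\<close> removes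
  it.  Comparing the leading behaviour at 0 of both sides of the functional equation
  forces \<open>c\<close> to be a power of \<open>q\<close>; the remaining factor is invariant under \<open>u \<mapsto> q u\<close> and thus
  constant, by continuity at 0.
\<close>

lemma q_homogeneous_monomial:
  fixes H :: "complex \<Rightarrow> complex"
  assumes q: "q \<noteq> 0" "norm q < 1" and H: "H holomorphic_on -{0}"
    and c: "\<And>u. u \<noteq> 0 \<Longrightarrow> H (q * u) = c * H u" and nz: "w \<noteq> 0" "H w \<noteq> 0"
  obtains h j where "h \<noteq> 0" "c = q powi j" "\<And>u. u \<noteq> 0 \<Longrightarrow> H u = h * u powi j"
proof -
  obtain M where M: "norm q ^ M * norm c \<le> 1"
  proof -
    have "(\<lambda>n. norm q ^ n * norm c) \<longlonglongrightarrow> 0" by (rule tendsto_mult_left_zero[OF LIMSEQ_power_zero]) (use q in simp)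
    then have "eventually (\<lambda>n. norm q ^ n * norm c < 1) sequentially" by (rule order_tendstoD) simp
    then show ?thesis using that by (auto simp: eventually_sequentially intro: less_imp_le)
  qed
  have iter: "u ^ M * H u = (q ^ M * c) ^ n * ((u / q ^ n) ^ M * H (u / q ^ n))" if "u \<noteq> 0" for u n
  proof (induction n)
    case (Suc n)
    have "H (u / q ^ n) = c * H (u / q ^ Suc n)"
      using c[of "u / q ^ Suc n"] that q by simp
    then show ?case using Suc q by (simp add: power_mult_distrib power_divide field_simps)
  qed simp
  \<comment> \<open>The closed annulus between \<open>norm q\<close> and 1 is a compact fundamental domain.\<close>
  obtain B where B: "\<And>u. norm q \<le> norm u \<Longrightarrow> norm u \<le> 1 \<Longrightarrow> norm (u ^ M * H u) \<le> B"
  proof -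
    let ?A = "cball 0 1 - ball (0::complex) (norm q)"
    have "compact ?A" by (intro compact_diff) auto
    moreover have "continuous_on ?A (\<lambda>u. u ^ M * H u)"
      by (intro continuous_intros continuous_on_subset[OF holomorphic_on_imp_continuous_on[OF H]]) (use q in auto)
    ultimately have "bounded ((\<lambda>u. u ^ M * H u) ` ?A)" by (intro compact_imp_bounded compact_continuous_image)
    then obtain B where "\<forall>u\<in>?A. norm (u ^ M * H u) \<le> B" unfolding bounded_iff by auto
    then show ?thesis by (intro that[of B]) auto
  qed
  have bd: "norm (u ^ M * H u) \<le> B" if u: "u \<noteq> 0" "norm u \<le> 1" for u
  proof -
    have "(\<lambda>n. norm q ^ n) \<longlonglongrightarrow> 0" using q by (intro LIMSEQ_power_zero) simp
    then have "eventually (\<lambda>n. norm q ^ n < norm u) sequentially" by (rule order_tendstoD) (use u in simp)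
    then have ex: "\<exists>n. norm q ^ Suc n \<le> norm u"
      unfolding eventually_sequentially by (meson le_Suc_eq less_imp_le order_refl)
    define n where "n = (LEAST n. norm q ^ Suc n \<le> norm u)"
    have n1: "norm q ^ Suc n \<le> norm u" unfolding n_def using ex by (rule LeastI_ex)
    have n2: "norm u \<le> norm q ^ n"
    proof (cases n)
      case (Suc k)
      then have "\<not> norm q ^ Suc k \<le> norm u" using not_less_Least[of k "\<lambda>n. norm q ^ Suc n \<le> norm u"] by (simp add: n_def)
      then show ?thesis using Suc by simp
    qed (use u in simp)
    have "norm ((u / q ^ n) ^ M * H (u / q ^ n)) \<le> B"
      by (rule B) (use n1 n2 q in \<open>simp_all add: norm_divide norm_power field_simps\<close>)
    moreover have "norm ((q ^ M * c) ^ n) \<le> 1"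
      using M by (simp add: norm_power norm_mult power_le_one)
    ultimately show ?thesis
      unfolding iter[OF u(1), of n] norm_mult[of "(q ^ M * c) ^ n"] using mult_mono[of "norm ((q ^ M * c) ^ n)" 1] by fastforce
  qed
  have "\<exists>E. E holomorphic_on UNIV \<and> (\<forall>u\<in>UNIV - {0}. E u = u ^ M * H u)"
  proof (rule holomorphic_on_extend)
    show "(\<lambda>u. u ^ M * H u) holomorphic_on UNIV - {0}"
      by (intro holomorphic_intros holomorphic_on_subset[OF H]) auto
    have "eventually (\<lambda>u::complex. u \<in> ball 0 1 - {0}) (at 0)" by (rule eventually_at_in_open) auto
    then have "eventually (\<lambda>u. norm (u ^ M * H u) \<le> B * norm (1::complex)) (at 0)"
      by eventually_elim (use bd in auto)
    then show "(\<lambda>u. u ^ M * H u) \<in> O[at 0](\<lambda>_. 1)" by (rule bigoI)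
  qed auto
  then obtain E where E: "E holomorphic_on UNIV" "\<And>u. u \<noteq> 0 \<Longrightarrow> E u = u ^ M * H u" by auto
  \<comment> \<open>The extra factor \<open>u\<close> ensures a zero at 0, as the local factorization below requires.\<close>
  define E1 where "E1 u = u * E u" for u
  have E1: "E1 u = u ^ Suc M * H u" for u by (cases "u = 0") (auto simp: E1_def E)
  have nc: "\<not> E1 constant_on UNIV"
  proof
    assume "E1 constant_on UNIV"
    then have "E1 w = E1 0" by (auto simp: constant_on_def)
    then show False using nz by (simp add: E1)
  qed
  obtain g r n where g: "0 < n" "0 < r" "g holomorphic_on ball 0 r"
      "\<And>u. u \<in> ball 0 r \<Longrightarrow> E1 u = (u - 0) ^ n * g u" "\<And>u. u \<in> ball 0 r \<Longrightarrow> g u \<noteq> 0"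
    by (rule holomorphic_factor_zero_nonconstant[of E1 UNIV 0])
       (use nc E(1) in \<open>auto simp: E1 E1_def[abs_def] intro!: holomorphic_intros\<close>)
  have inb: "q * u \<in> ball 0 r" if "u \<in> ball 0 r" for u
    using that q mult_left_le_one_le[of "norm u" "norm q"] by (auto simp: norm_mult)
  have Eq: "E1 (q * u) = q ^ Suc M * c * E1 u" for u
    by (cases "u = 0") (auto simp: E1 c power_mult_distrib)
  have gq: "q ^ n * g (q * u) = q ^ Suc M * c * g u" if "u \<in> ball 0 r" "u \<noteq> 0" for u
    using Eq[of u] g(4)[OF that(1)] g(4)[OF inb[OF that(1)]] that by (simp add: power_mult_distrib mult_ac)
  have gc: "isCont g 0"
    by (rule field_differentiable_imp_continuous_at, rule holomorphic_on_imp_differentiable_at[OF g(3)]) (use g(2) in auto)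
  have seq: "(\<lambda>k. q ^ k * u) \<longlonglongrightarrow> 0" for u by (rule tendsto_mult_left_zero[OF LIMSEQ_power_zero]) (rule q)
  have g0: "(\<lambda>k. g (q ^ k * u)) \<longlonglongrightarrow> g 0" for u by (rule isCont_tendsto_compose[OF gc seq])
  have inbk: "q ^ k * u \<in> ball 0 r" if "u \<in> ball 0 r" for u k
    by (induction k) (use that inb in \<open>auto simp: mult.assoc\<close>)
  have qn: "q ^ n = q ^ Suc M * c"
  proof -
    define u where "u = complex_of_real (r / 2)"
    have u: "u \<in> ball 0 r" "u \<noteq> 0" using g(2) by (auto simp: u_def)
    have "(\<lambda>k. q ^ n * g (q ^ Suc k * u)) \<longlonglongrightarrow> q ^ n * g 0"
      by (intro tendsto_intros LIMSEQ_Suc g0)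
    moreover have "(\<lambda>k. q ^ n * g (q ^ Suc k * u)) = (\<lambda>k. q ^ Suc M * c * g (q ^ k * u))"
      using gq[OF inbk[OF u(1)]] u q by (simp add: mult.assoc)
    moreover have "(\<lambda>k. q ^ Suc M * c * g (q ^ k * u)) \<longlonglongrightarrow> q ^ Suc M * c * g 0"
      by (intro tendsto_intros g0)
    ultimately have "q ^ n * g 0 = q ^ Suc M * c * g 0" using LIMSEQ_unique by metis
    then show ?thesis using g(2) g(5)[of 0] by simp
  qed
  define j where "j = int n - int (Suc M)"
  have cj: "c = q powi j" using qn q by (simp add: j_def power_int_diff field_simps del: of_nat_Suc)
  have Hs: "H u = g 0 * u powi j" if u: "u \<noteq> 0" "u \<in> ball 0 r" for u
  proof -
    have "g (q ^ k * u) = g u" for k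
    proof (induction k)
      case (Suc k)
      have "q ^ n * g (q ^ Suc k * u) = q ^ n * g (q ^ k * u)"
        using gq[OF inbk[OF u(2)], of k] u q unfolding qn by (simp add: mult.assoc)
      then show ?case using Suc q by simp
    qed simp
    then have "g 0 = g u" using g0[of u] by (simp add: LIMSEQ_const_iff)
    then have "u ^ Suc M * H u = u ^ n * g 0" using g(4)[OF u(2)] E1 by simp
    then show ?thesis using u by (simp add: j_def power_int_diff field_simps del: of_nat_Suc)
  qed
  have "H u = g 0 * u powi j" if u: "u \<noteq> 0" for u
  proof -
    have "eventually (\<lambda>k. q ^ k * u \<in> ball 0 r) sequentially"
      by (rule topological_tendstoD[OF seq]) (use g(2) in auto)
    then obtain k where k: "q ^ k * u \<in> ball 0 r" by (auto simp: eventually_sequentially)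
    have "H (q ^ i * u) = c ^ i * H u" for i
      by (induction i) (use c u q in \<open>auto simp: mult.assoc\<close>)
    then have "c ^ k * H u = g 0 * (q ^ k * u) powi j" using Hs[OF _ k] u q by simp
    also have "(q ^ k * u) powi j = c ^ k * u powi j"
      using q u by (simp add: power_int_mult_distrib cj power_int_power power_int_power' mult.commute)
    finally show ?thesis using cj q by simp
  qed
  then show thesis using that[OF _ cj] g(5)[of 0] g(2) by simp
qed

text \<open>
  The zeros of \<open>F\<close> contain the orbits of the points \<open>v k\<close>, which are the zeros of the product of
  theta functions, all simple.  The quotient has a constant multiplier and is a monomial by
  \<open>q_homogeneous_monomial\<close>.
\<close>

lemma theta_factorization:
  assumes q: "q \<noteq> 0" "norm q < 1" and I: "finite I" and v: "\<And>k. k \<in> I \<Longrightarrow> v k \<noteq> 0"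
    and dist: "\<And>i k j. i \<in> I \<Longrightarrow> k \<in> I \<Longrightarrow> i \<noteq> k \<Longrightarrow> v i \<noteq> v k * q powi j"
    and F: "F holomorphic_on -{0}" and Fq: "\<And>u. u \<noteq> 0 \<Longrightarrow> F (q * u) = kap / u ^ card I * F u"
    and kap: "kap \<noteq> 0" and Fv: "\<And>k. k \<in> I \<Longrightarrow> F (v k) = 0" and w: "w \<noteq> 0" "F w \<noteq> 0"
  obtains h j where "h \<noteq> 0" "kap = (-1) ^ card I * (\<Prod>k\<in>I. v k) * q powi j"
    "\<And>u. u \<noteq> 0 \<Longrightarrow> F u = h * u powi j * (\<Prod>k\<in>I. qtheta q (u / v k))"
proof -
  define Q where "Q u = (\<Prod>k\<in>I. qtheta q (u / v k))" for u
  define V where "V = (-1) ^ card I * (\<Prod>k\<in>I. v k)"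
  have V0: "V \<noteq> 0" using I v by (simp add: V_def)
  have Q: "Q holomorphic_on -{0}" unfolding Q_def
    by (intro holomorphic_intros holomorphic_on_compose_gen[OF _ qtheta_holomorphic[OF q], unfolded o_def]) (use v in auto)
  have Qq: "Q (q * u) = V / u ^ card I * Q u" if "u \<noteq> 0" for u
    unfolding Q_def V_def using qtheta_prod_shift[OF q I v that] .
  have Fz: "F (v k * q powi j) = 0" if k: "k \<in> I" for k j
  proof (induction j rule: int_induct[where k = 0])
    case base
    then show ?case using Fv[OF k] by simp
  next
    case (step1 j)
    then show ?case using Fq[of "v k * q powi j"] v[OF k] q by (simp add: power_int_add mult_ac)
  next
    case (step2 j)
    then show ?case using Fq[of "v k * q powi (j - 1)"] v[OF k] q kap by (simp add: power_int_diff mult_ac)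
  qed
  obtain H where H: "H holomorphic_on -{0}" "\<And>u. u \<in> -{0} \<Longrightarrow> F u = Q u * H u"
  proof (rule holomorphic_divide_simple_zeros[OF F Q])
    fix a :: complex assume a: "a \<in> -{0}" "Q a = 0"
    then obtain k j where "k \<in> I" "a = v k * q powi j" "deriv Q a \<noteq> 0"
      using qtheta_prod_simple_zeros[where a = a and v = v, OF q I v dist] unfolding Q_def[abs_def] by auto
    then show "F a = 0 \<and> deriv Q a \<noteq> 0" using Fz by simp
  qed auto
  \<comment> \<open>Cancelling \<open>Q\<close> is possible only off its zeros; the identity theorem does the rest.\<close>
  have Hq: "H (q * u) = kap / V * H u" if u: "u \<noteq> 0" for u
  proof (rule analytic_continuation_open[of "-{0} \<inter> Q -` (-{0})" "-{0}" "\<lambda>u. H (q * u)" "\<lambda>u. kap / V * H u"])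
    show "open (-{0} \<inter> Q -` (-{0}))"
      by (rule continuous_open_preimage[OF holomorphic_on_imp_continuous_on[OF Q]]) auto
    show "-{0} \<inter> Q -` (-{0}) \<noteq> {}" using w H(2)[of w] by auto
    show "connected (-{0::complex})" by (rule connected_punctured_universe) simp
    show "(\<lambda>u. H (q * u)) holomorphic_on -{0}"
      by (rule holomorphic_on_compose_gen[OF _ H(1), unfolded o_def]) (use q in \<open>auto intro!: holomorphic_intros\<close>)
    show "(\<lambda>u. kap / V * H u) holomorphic_on -{0}" by (intro holomorphic_intros H(1))
    fix x assume x: "x \<in> -{0} \<inter> Q -` (-{0})"
    have "V / x ^ card I * Q x * H (q * x) = kap / x ^ card I * (Q x * H x)"
      using H(2)[of "q * x"] H(2)[of x] Fq[of x] Qq[of x] x q by simp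
    then show "H (q * x) = kap / V * H x" using x V0 by (simp add: field_simps)
  qed (use u in auto)
  have Hw: "H w \<noteq> 0" using w H(2)[of w] by auto
  obtain h j where h: "h \<noteq> 0" "kap / V = q powi j" "\<And>u. u \<noteq> 0 \<Longrightarrow> H u = h * u powi j"
    using q_homogeneous_monomial[OF q H(1) Hq w(1) Hw] by metis
  show thesis
  proof (rule that[OF h(1)])
    show "kap = (-1) ^ card I * (\<Prod>k\<in>I. v k) * q powi j" using h(2) V0 unfolding V_def[symmetric] by (simp add: field_simps)
    show "F u = h * u powi j * (\<Prod>k\<in>I. qtheta q (u / v k))" if "u \<noteq> 0" for u
      using H(2)[of u] h(3)[of u] that by (simp add: Q_def)
  qed
qed

text \<open>
  Each factor is an entire function of \<open>u\<close> times an entire function of \<open>1/u\<close>, so the whole product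
  has a Laurent series, by \<open>laurent_exists\<close>.  The recurrence for its coefficients is the
  functional equation of the product read off coefficientwise.
\<close>

lemma theta_product_laurent:
  assumes q: "q \<noteq> 0" "norm q < 1" and I: "finite I" and v: "\<And>k. k \<in> I \<Longrightarrow> v k \<noteq> 0"
  obtains c :: "int \<Rightarrow> complex" where
    "\<And>u. u \<noteq> 0 \<Longrightarrow> ((\<lambda>m. c m * u powi m) has_sum u powi j * (\<Prod>k\<in>I. qtheta q (u / v k))) UNIV"
    "c \<noteq> (\<lambda>_. 0)"
    "\<And>m. (-1) ^ card I * (\<Prod>k\<in>I. v k) * q powi j * c (m + int (card I)) = q powi m * c m"
proof -
  define F where "F u = u powi j * (\<Prod>k\<in>I. qtheta q (u / v k))" for u
  define kap where "kap = (-1) ^ card I * (\<Prod>k\<in>I. v k) * q powi j"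
  have "(\<lambda>u. \<Prod>k\<in>I. qpoch q (u / v k)) holomorphic_on UNIV" "(\<lambda>u. \<Prod>k\<in>I. qpoch q (q * v k * u)) holomorphic_on UNIV"
    by (intro holomorphic_intros holomorphic_on_compose_gen[OF _ qpoch_holomorphic[OF q], unfolded o_def]; use v in auto)+
  then obtain c where "\<And>u. u \<noteq> 0 \<Longrightarrow> ((\<lambda>m. c m * u powi m) has_sum u powi j * ((\<Prod>k\<in>I. qpoch q (u / v k)) * (\<Prod>k\<in>I. qpoch q (q * v k * (1 / u))))) UNIV"
    by (rule laurent_exists[where j = j]) (use that in blast)
  then have c: "((\<lambda>m. c m * u powi m) has_sum F u) UNIV" if "u \<noteq> 0" for u
    using that by (simp add: F_def qtheta_def prod.distrib)
  have Fq: "F (q * u) = kap * u powi (- int (card I)) * F u" if "u \<noteq> 0" for u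
    using qtheta_prod_shift[OF q I v that] that
    by (simp add: F_def kap_def power_int_mult_distrib power_int_minus field_simps)
  have "\<exists>w. w \<noteq> 0 \<and> F w \<noteq> 0"
  proof (rule ccontr)
    assume no: "\<not> (\<exists>w. w \<noteq> 0 \<and> F w \<noteq> 0)"
    \<comment> \<open>The plane is uncountable, but the zeros of the theta factors form a countable set.\<close>
    have "UNIV \<subseteq> insert 0 (\<Union>k\<in>I. range (\<lambda>j. v k * q powi j))"
    proof
      fix w :: complex
      show "w \<in> insert 0 (\<Union>k\<in>I. range (\<lambda>j. v k * q powi j))"
      proof (cases "w = 0")
        case False
        then have "F w = 0" using no by blast
        then obtain k where k: "k \<in> I" "qtheta q (w / v k) = 0" using I False by (auto simp: F_def)
        obtain j where "w / v k = q powi j" using qtheta_zero_imp[OF q k(2)] False v[OF k(1)] by auto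
        then have "w = v k * q powi j" using v[OF k(1)] by (simp add: field_simps)
        then show ?thesis using k(1) by blast
      qed simp
    qed
    moreover have "countable (insert 0 (\<Union>k\<in>I. range (\<lambda>j. v k * q powi j)))"
      using I by (intro countable_insert countable_UN countable_image) (auto intro: countable_finite)
    ultimately show False using countable_subset uncountable_UNIV_complex by blast
  qed
  then obtain w where w: "w \<noteq> 0" "F w \<noteq> 0" by blast
  have "c \<noteq> (\<lambda>_. 0)"
  proof
    assume "c = (\<lambda>_. 0)"
    then have "((\<lambda>m. 0) has_sum F w) (UNIV :: int set)" using c[OF w(1)] by simp
    then show False using w(2) has_sum_unique[OF _ has_sum_0_simp] by blast
  qed
  moreover have "(\<lambda>m. kap * c (m + int (card I))) = (\<lambda>m. q powi m * c m)"
  proof (rule laurent_coeffs_unique[where F = "\<lambda>u. F (q * u)"])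
    fix u :: complex assume u: "u \<noteq> 0"
    show "((\<lambda>m. q powi m * c m * u powi m) has_sum F (q * u)) UNIV"
      using c[of "q * u"] u q by (simp add: power_int_mult_distrib mult_ac)
    have "((\<lambda>m. kap * u powi (- int (card I)) * (c m * u powi m)) has_sum F (q * u)) UNIV"
      unfolding Fq[OF u] by (rule has_sum_cmult_right[OF c[OF u]])
    then show "((\<lambda>m. kap * c (m + int (card I)) * u powi m) has_sum F (q * u)) UNIV"
      by (rule has_sum_reindex_bij_witness[THEN iffD1, of UNIV "\<lambda>m. m + int (card I)" "\<lambda>m. m - int (card I)", rotated 6])
         (use u in \<open>auto simp: power_int_diff power_int_minus field_simps\<close>)
  qed
  ultimately show thesis using that[of c] c by (simp add: F_def kap_def fun_eq_iff)
qed

section \<open>Gaussians in the Feichtinger algebra\<close>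

lemma gauss_integrable:
  fixes b m :: real
  assumes "b > 0" shows "integrable lborel (\<lambda>u. exp (- (b * (u - m)\<^sup>2)))"
proof -
  define c where "c = sqrt (b / pi)"
  have c: "c > 0" "pi * c\<^sup>2 = b" using assms by (auto simp: c_def)
  have "integrable lborel (\<lambda>u. exp (- (pi * ((0 + c * u) - c * m)\<^sup>2)))"
    by (rule lborel_integrable_real_affine[OF gauss_shift_integrable]) (use c in simp)
  moreover have "pi * ((0 + c * u) - c * m)\<^sup>2 = b * (u - m)\<^sup>2" for u
  proof -
    have "(0 + c * u) - c * m = c * (u - m)" by (simp add: algebra_simps)
    then have "pi * ((0 + c * u) - c * m)\<^sup>2 = (pi * c\<^sup>2) * (u - m)\<^sup>2" by (simp only: power_mult_distrib mult.assoc)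
    then show ?thesis unfolding c(2) .
  qed
  ultimately show ?thesis by simp
qed

lemma gauss_fourier:
  assumes "a > 0"
  shows "(LINT u|lborel. complex_of_real (exp (- (pi * a * (u - m)\<^sup>2))) * iexp (s * u))
    = complex_of_real (exp (- s\<^sup>2 / (4 * pi * a)) / sqrt a) * iexp (s * m)"
proof -
  define c where "c = sqrt (2 * pi * a)"
  have c: "c > 0" "c\<^sup>2 = 2 * pi * a" using assms by (auto simp: c_def)
  have e1: "exp (- (pi * a * ((m + (1 / c) * v) - m)\<^sup>2)) = sqrt (2 * pi) * std_normal_density v" for v
    using c assms by (simp add: std_normal_density_def power_divide field_simps)
  have "(LINT u|lborel. complex_of_real (exp (- (pi * a * (u - m)\<^sup>2))) * iexp (s * u))
    = \<bar>1 / c\<bar> *\<^sub>R (LINT v|lborel. complex_of_real (exp (- (pi * a * ((m + (1 / c) * v) - m)\<^sup>2))) * iexp (s * (m + (1 / c) * v)))"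
    by (rule lborel_integral_real_affine) (use c in simp)
  also have "(\<lambda>v. complex_of_real (exp (- (pi * a * ((m + (1 / c) * v) - m)\<^sup>2))) * iexp (s * (m + (1 / c) * v)))
    = (\<lambda>v. (complex_of_real (sqrt (2 * pi)) * iexp (s * m)) * (complex_of_real (std_normal_density v) * iexp ((s / c) * v)))"
    unfolding e1 by (simp add: exp_add[symmetric] algebra_simps fun_eq_iff)
  also have "\<bar>1 / c\<bar> *\<^sub>R (LINT v|lborel. (complex_of_real (sqrt (2 * pi)) * iexp (s * m)) * (complex_of_real (std_normal_density v) * iexp ((s / c) * v)))
    = complex_of_real (\<bar>1 / c\<bar> * sqrt (2 * pi) * exp (- (s / c)\<^sup>2 / 2)) * iexp (s * m)"
    by (simp only: integral_mult_right_zero std_normal_fourier(2)) (simp add: scaleR_conv_of_real)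
  also have "\<bar>1 / c\<bar> * sqrt (2 * pi) * exp (- (s / c)\<^sup>2 / 2) = exp (- s\<^sup>2 / (4 * pi * a)) / sqrt a"
  proof -
    have "\<bar>1 / c\<bar> * sqrt (2 * pi) = 1 / sqrt a" using c(1) assms by (simp add: c_def real_sqrt_mult)
    moreover have "- (s / c)\<^sup>2 / 2 = - s\<^sup>2 / (4 * pi * a)" unfolding power_divide c(2) by simp
    ultimately show ?thesis by simp
  qed
  finally show ?thesis .
qed

lemma tf_shift_gauss:
  "tf_shift (x, \<xi>) (gauss lam) t = iexp (2 * pi * \<xi> * t) * complex_of_real (exp (- (pi * lam * (t - x)\<^sup>2)))"
  by (simp add: tf_shift_def modul_def transl_def gauss_def mult_ac)

text \<open>
  The product of the two Gaussians is again a Gaussian, centred at the weighted mean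
  \<open>(\<lambda> x\<^sub>0 + x) / (\<lambda> + 1)\<close>, so the transform is a Gaussian in \<open>(x, \<xi>)\<close> up to a phase.  The closed
  form gives measurability and integrability together.
\<close>

lemma stft_tf_shift_gauss:
  assumes "lam > 0"
  shows "stft (gauss 1) (tf_shift (x\<^sub>0, \<xi>\<^sub>0) (gauss lam)) (x, \<xi>) =
    complex_of_real (exp (- (pi * lam / (lam + 1) * (x - x\<^sub>0)\<^sup>2)) * exp (- (pi / (lam + 1) * (\<xi> - \<xi>\<^sub>0)\<^sup>2)) / sqrt (lam + 1))
      * iexp (2 * pi * (\<xi>\<^sub>0 - \<xi>) * ((lam * x\<^sub>0 + x) / (lam + 1)))"
proof -
  define m where "m = (lam * x\<^sub>0 + x) / (lam + 1)"
  define d where "d = pi * lam / (lam + 1) * (x - x\<^sub>0)\<^sup>2"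
  define s where "s = 2 * pi * (\<xi>\<^sub>0 - \<xi>)"
  have sq: "pi * lam * (u - x\<^sub>0)\<^sup>2 + pi * (u - x)\<^sup>2 = d + pi * (lam + 1) * (u - m)\<^sup>2" for u
  proof -
    have "(lam + 1) * (lam * (u - x\<^sub>0)\<^sup>2 + (u - x)\<^sup>2) = lam * (x - x\<^sub>0)\<^sup>2 + ((lam + 1) * u - (lam * x\<^sub>0 + x))\<^sup>2"
      by (simp add: algebra_simps power2_eq_square)
    also have "(lam + 1) * u - (lam * x\<^sub>0 + x) = (lam + 1) * (u - m)"
      using assms by (simp add: m_def field_simps)
    finally have *: "(lam + 1) * (lam * (u - x\<^sub>0)\<^sup>2 + (u - x)\<^sup>2) = lam * (x - x\<^sub>0)\<^sup>2 + ((lam + 1) * (u - m))\<^sup>2" .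
    have "(lam + 1) * (pi * lam * (u - x\<^sub>0)\<^sup>2 + pi * (u - x)\<^sup>2) = pi * ((lam + 1) * (lam * (u - x\<^sub>0)\<^sup>2 + (u - x)\<^sup>2))"
      by (simp add: algebra_simps)
    also have "\<dots> = (lam + 1) * (d + pi * (lam + 1) * (u - m)\<^sup>2)"
    proof -
      have A: "(lam + 1) * d = pi * (lam * (x - x\<^sub>0)\<^sup>2)" using assms by (simp add: d_def)
      have B: "pi * ((lam + 1) * (u - m))\<^sup>2 = (lam + 1) * (pi * (lam + 1) * (u - m)\<^sup>2)"
        by (simp add: power2_eq_square mult_ac)
      show ?thesis by (simp only: * distrib_left[of pi "lam * _"] distrib_left[of _ d] A B)
    qed
    finally show ?thesis using assms by simp
  qed
  have "stft (gauss 1) (tf_shift (x\<^sub>0, \<xi>\<^sub>0) (gauss lam)) (x, \<xi>)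
    = (LINT u|lborel. complex_of_real (exp (- d)) * (complex_of_real (exp (- (pi * (lam + 1) * (u - m)\<^sup>2))) * iexp (s * u)))"
    unfolding stft_gauss_eq
  proof (intro Bochner_Integration.integral_cong refl)
    fix u
    have "exp (- (pi * lam * (u - x\<^sub>0)\<^sup>2)) * exp (- (pi * (u - x)\<^sup>2)) = exp (- d) * exp (- (pi * (lam + 1) * (u - m)\<^sup>2))"
      unfolding exp_add[symmetric] using sq[of u] by simp
    then have 1: "complex_of_real (exp (- (pi * lam * (u - x\<^sub>0)\<^sup>2))) * complex_of_real (exp (- (pi * (u - x)\<^sup>2))) = complex_of_real (exp (- d)) * complex_of_real (exp (- (pi * (lam + 1) * (u - m)\<^sup>2)))"
      unfolding of_real_mult[symmetric] by (rule arg_cong)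
    have 2: "iexp (2 * pi * \<xi>\<^sub>0 * u) * iexp (- (2 * pi * \<xi> * u)) = iexp (s * u)"
      unfolding exp_add[symmetric] by (simp add: s_def algebra_simps)
    have "tf_shift (x\<^sub>0, \<xi>\<^sub>0) (gauss lam) u * gauss 1 (u - x) * iexp (- (2 * pi * \<xi> * u))
      = (complex_of_real (exp (- (pi * lam * (u - x\<^sub>0)\<^sup>2))) * complex_of_real (exp (- (pi * (u - x)\<^sup>2)))) * (iexp (2 * pi * \<xi>\<^sub>0 * u) * iexp (- (2 * pi * \<xi> * u)))"
      unfolding tf_shift_gauss by (simp add: gauss_def mult_ac)
    then show "tf_shift (x\<^sub>0, \<xi>\<^sub>0) (gauss lam) u * gauss 1 (u - x) * iexp (- (2 * pi * \<xi> * u))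
      = complex_of_real (exp (- d)) * (complex_of_real (exp (- (pi * (lam + 1) * (u - m)\<^sup>2))) * iexp (s * u))"
      unfolding 1 2 by (simp only: mult.assoc)
  qed
  also have "\<dots> = complex_of_real (exp (- d)) * (complex_of_real (exp (- s\<^sup>2 / (4 * pi * (lam + 1))) / sqrt (lam + 1)) * iexp (s * m))"
    using gauss_fourier[of "lam + 1" m s] assms by simp
  also have "- s\<^sup>2 / (4 * pi * (lam + 1)) = - (pi / (lam + 1) * (\<xi> - \<xi>\<^sub>0)\<^sup>2)"
    using assms by (simp add: s_def power_mult_distrib power2_commute[of \<xi>\<^sub>0] power2_eq_square[of pi])
  finally show ?thesis unfolding d_def s_def m_def by simp
qed

lemma tf_shift_gauss_S0:
  assumes lam: "lam > 0" shows "tf_shift z (gauss lam) \<in> S0"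
proof -
  obtain x\<^sub>0 \<xi>\<^sub>0 where z: "z = (x\<^sub>0, \<xi>\<^sub>0)" by (cases z)
  let ?g = "tf_shift (x\<^sub>0, \<xi>\<^sub>0) (gauss lam)"
  have cont: "continuous_on UNIV ?g" unfolding tf_shift_gauss[abs_def] by (intro continuous_intros)
  have "(cmod (?g t))\<^sup>2 = exp (- (2 * pi * lam * (t - x\<^sub>0)\<^sup>2))" for t
    unfolding tf_shift_gauss by (simp add: norm_mult exp_double[symmetric])
  then have L2: "?g \<in> L2_fun"
    unfolding L2_fun_def using gauss_integrable[of "2 * pi * lam" x\<^sub>0] lam borel_measurable_continuous_onI[OF cont] by simp
  have "integrable (lborel \<Otimes>\<^sub>M lborel) (stft (gauss 1) ?g)"
  proof (rule Bochner_Integration.integrable_bound)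
    let ?A = "\<lambda>x. exp (- (pi * lam / (lam + 1) * (x - x\<^sub>0)\<^sup>2))" and ?B = "\<lambda>\<xi>. exp (- (pi / (lam + 1) * (\<xi> - \<xi>\<^sub>0)\<^sup>2))"
    have A: "integrable lborel ?A" and B: "integrable lborel ?B"
      using gauss_integrable[of "pi * lam / (lam + 1)"] gauss_integrable[of "pi / (lam + 1)"] lam by auto
    show "integrable (lborel \<Otimes>\<^sub>M lborel) (\<lambda>p. ?A (fst p) * ?B (snd p))"
      using lborel_pair.Fubini_integrable[of "\<lambda>p. ?A (fst p) * ?B (snd p)"] A B by (simp add: abs_mult)
    have e: "stft (gauss 1) ?g = (\<lambda>(x, \<xi>). complex_of_real (?A x * ?B \<xi> / sqrt (lam + 1))
      * iexp (2 * pi * (\<xi>\<^sub>0 - \<xi>) * ((lam * x\<^sub>0 + x) / (lam + 1))))"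
      using stft_tf_shift_gauss[OF lam] by (auto simp: fun_eq_iff)
    show "stft (gauss 1) ?g \<in> borel_measurable (lborel \<Otimes>\<^sub>M lborel)"
      unfolding e by measurable
    show "AE p in lborel \<Otimes>\<^sub>M lborel. norm (stft (gauss 1) ?g p) \<le> norm (?A (fst p) * ?B (snd p))"
    proof (rule AE_I2)
      fix p :: "real \<times> real"
      have "1 \<le> sqrt (lam + 1)" using lam by simp
      then show "norm (stft (gauss 1) ?g p) \<le> norm (?A (fst p) * ?B (snd p))"
        using divide_left_mono[of 1 "sqrt (lam + 1)" "?A (fst p) * ?B (snd p)"] lam
        unfolding e by (simp add: case_prod_unfold norm_mult norm_divide)
    qed
  qed
  then show ?thesis using cont L2 by (simp add: S0_def z lborel_prod)
qed

section \<open>The short-time Fourier transform as a theta function\<close>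

text \<open>
  The Laurent coefficients of the theta function that belongs to \<open>train_comb N a\<close>.
\<close>

definition train_coeff :: "real \<Rightarrow> nat \<Rightarrow> (nat \<Rightarrow> complex) \<Rightarrow> int \<Rightarrow> complex" where
  "train_coeff lam N a m = a (nat (m mod int N)) * complex_of_real (exp (- (pi * lam * (of_int m / real N)\<^sup>2)))"

text \<open>
  The coordinate on \<open>\<complex>\<^sup>* / q\<^sup>\<int>\<close> of a point of the time-frequency plane: the period 1 in \<open>x\<close> becomes
  multiplication by \<open>exp (2 * pi * lam / N)\<close>, and the period \<open>N\<close> in \<open>\<xi>\<close> disappears.
\<close>

definition tf_point :: "real \<Rightarrow> nat \<Rightarrow> real \<times> real \<Rightarrow> complex" where
  "tf_point lam N z = exp (2 * of_real pi * (of_real (lam * fst z) - \<i> * of_real (snd z)) / of_nat N)"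

lemma tf_point_nonzero: "tf_point lam N z \<noteq> 0"
  by (simp add: tf_point_def)

lemma tf_point_surj:
  assumes "N \<ge> 1" "lam > 0" "u \<noteq> 0" obtains z where "u = tf_point lam N z"
proof -
  define w where "w = of_nat N * Ln u / (2 * of_real pi)"
  have "of_real (lam * (Re w / lam)) - \<i> * of_real (- Im w) = w"
    using assms by (simp add: complex_eq_iff)
  then have "tf_point lam N (Re w / lam, - Im w) = exp (2 * of_real pi * w / of_nat N)"
    unfolding tf_point_def fst_conv snd_conv by simp
  also have "2 * of_real pi * w / of_nat N = Ln u" using assms by (simp add: w_def)
  also have "exp (Ln u) = u" using assms by simp
  finally show thesis using that by metis
qed

text \<open>
  Expanding \<open>(t - x)\<^sup>2\<close> at the support points \<open>t = m/N\<close> of the trains separates a factor in \<open>x\<close> alone, a Gaussian in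
  \<open>m\<close>, and the \<open>m\<close>-th power of the coordinate.  The train \<open>\<epsilon>\<^sub>n\<close> contributes the \<open>m\<close> congruent to \<open>n\<close>
  modulo \<open>N\<close>; convergence comes from the absolute summability of samples of functions in \<open>S0\<close>.
\<close>

lemma dual_stft_train_comb:
  assumes N: "N \<ge> 1" and lam: "lam > 0"
  shows "((\<lambda>m. train_coeff lam N a m * tf_point lam N z powi m) has_sum
    complex_of_real (exp (pi * lam * (fst z)\<^sup>2)) * dual_stft (gauss lam) (train_comb N a) z) UNIV"
proof -
  obtain x \<xi> where z: "z = (x, \<xi>)" by (cases z)
  let ?g = "tf_shift z (gauss lam)" and ?u = "tf_point lam N z"
  define E where "E = complex_of_real (exp (pi * lam * x\<^sup>2))"
  have summand: "E * cnj (?g (of_int m / real N)) = complex_of_real (exp (- (pi * lam * (of_int m / real N)\<^sup>2))) * ?u powi m" for m :: int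
  proof -
    define t where "t = of_int m / real N"
    have "?u powi m = exp (of_int m * (2 * of_real pi * (of_real (lam * x) - \<i> * of_real \<xi>) / of_nat N))"
      unfolding tf_point_def z fst_conv snd_conv by (rule exp_power_int)
    also have "of_int m * (2 * of_real pi * (of_real (lam * x) - \<i> * of_real \<xi>) / of_nat N)
        = 2 * of_real pi * (of_real (lam * x) - \<i> * of_real \<xi>) * complex_of_real t"
      by (simp add: t_def)
    finally have u: "?u powi m = exp (2 * of_real pi * (of_real (lam * x) - \<i> * of_real \<xi>) * complex_of_real t)" .
    have "E * cnj (?g t) = exp (complex_of_real (pi * lam * x\<^sup>2) + (- (\<i> * of_real (2 * pi * \<xi> * t)) + complex_of_real (- (pi * lam * (t - x)\<^sup>2))))"
      unfolding E_def z tf_shift_gauss exp_add exp_of_real[symmetric] by (simp add: exp_cnj)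
    also have "\<dots> = exp (complex_of_real (- (pi * lam * t\<^sup>2)) + 2 * of_real pi * (of_real (lam * x) - \<i> * of_real \<xi>) * complex_of_real t)"
      by (rule arg_cong[of _ _ exp]) (simp add: algebra_simps power2_eq_square)
    also have "\<dots> = complex_of_real (exp (- (pi * lam * t\<^sup>2))) * ?u powi m"
      unfolding u exp_add exp_of_real ..
    finally show ?thesis unfolding t_def .
  qed
  have S0: "?g \<in> S0" by (rule tf_shift_gauss_S0[OF lam])
  let ?D = "\<lambda>n. range (\<lambda>k. int n + int N * k)"
  have inj: "inj (\<lambda>k. int n + int N * k)" for n using N by (auto simp: inj_def)
  have each: "((\<lambda>m. train_coeff lam N a m * ?u powi m) has_sum E * (a n * delta_train N n ?g)) (?D n)" if n: "n < N" for n
  proof -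
    have "((\<lambda>k. cnj (?g (real n / real N + of_int k))) has_sum delta_train N n ?g) UNIV"
      unfolding delta_train_S0[OF S0]
      by (rule has_sum_infsum) (rule Infinite_Sum.abs_summable_summable[OF S0_samples_abs_summable[OF S0]])
    then have "((\<lambda>k. E * a n * cnj (?g (real n / real N + of_int k))) has_sum E * a n * delta_train N n ?g) UNIV"
      by (rule has_sum_cmult_right)
    moreover have "E * a n * cnj (?g (real n / real N + of_int k)) = train_coeff lam N a (int n + int N * k) * ?u powi (int n + int N * k)" for k
    proof -
      have "real n / real N + of_int k = of_int (int n + int N * k) / real N" using N by (simp add: field_simps)
      then have "E * cnj (?g (real n / real N + of_int k)) = complex_of_real (exp (- (pi * lam * (of_int (int n + int N * k) / real N)\<^sup>2))) * ?u powi (int n + int N * k)"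
        using summand[of "int n + int N * k"] by metis
      moreover have "nat ((int n + int N * k) mod int N) = n" using n by simp
      ultimately show ?thesis unfolding train_coeff_def by (simp only: mult.assoc mult.left_commute[of E])
    qed
    ultimately show ?thesis unfolding has_sum_reindex[OF inj] o_def by (simp only: mult.assoc)
  qed
  have "((\<lambda>m. train_coeff lam N a m * ?u powi m) has_sum (\<Sum>n<N. E * (a n * delta_train N n ?g))) (\<Union>n\<in>{..<N}. ?D n)"
  proof (rule sum_has_sum)
    fix i j assume "i \<in> {..<N}" "j \<in> {..<N}" "i \<noteq> j"
    then show "?D i \<inter> ?D j = {}"
    proof -
      have "(int i + int N * k) mod int N = int i" "(int j + int N * k) mod int N = int j" for k
        using \<open>i \<in> {..<N}\<close> \<open>j \<in> {..<N}\<close> by auto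
      then show ?thesis using \<open>i \<noteq> j\<close> by (auto, metis of_nat_eq_iff)
    qed
  qed (use each in auto)
  moreover have "(\<Union>n\<in>{..<N}. ?D n) = UNIV"
  proof -
    have "m \<in> ?D (nat (m mod int N))" for m
    proof
      show "m = int (nat (m mod int N)) + int N * (m div int N)" using N by simp
    qed simp
    moreover have "nat (m mod int N) \<in> {..<N}" for m using N by (simp add: nat_less_iff)
    ultimately show ?thesis by blast
  qed
  ultimately show ?thesis
    by (simp add: E_def z dual_stft_def train_comb_def sum_distrib_left)
qed

lemma train_coeff_zero_iff:
  assumes "N \<ge> 1" shows "train_coeff lam N a = (\<lambda>_. 0) \<longleftrightarrow> (\<forall>n<N. a n = 0)"
proof
  assume z: "train_coeff lam N a = (\<lambda>_. 0)"
  show "\<forall>n<N. a n = 0"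
  proof (intro allI impI)
    fix n assume "n < N"
    then show "a n = 0" using fun_cong[OF z, of "int n"] by (simp add: train_coeff_def)
  qed
next
  assume "\<forall>n<N. a n = 0"
  moreover have "nat (m mod int N) < N" for m using assms by (simp add: nat_less_iff)
  ultimately show "train_coeff lam N a = (\<lambda>_. 0)" by (auto simp: train_coeff_def)
qed

text \<open>
  The coordinate takes every nonzero value, so a vanishing transform is a vanishing Laurent
  series.  This also shows that the delta trains are linearly independent.
\<close>

lemma train_comb_zero_imp:
  assumes N: "N \<ge> 1" and lam: "lam > 0"
    and z: "\<And>z. dual_stft (gauss lam) (train_comb N a) z = 0"
  shows "\<forall>n<N. a n = 0"
proof -
  have "train_coeff lam N a = (\<lambda>_. 0)"
  proof (rule laurent_coeffs_unique[where F = "\<lambda>_. 0"])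
    fix u :: complex assume "u \<noteq> 0"
    then obtain p where "u = tf_point lam N p" using tf_point_surj[OF N lam] by metis
    then show "((\<lambda>m. train_coeff lam N a m * u powi m) has_sum 0) UNIV"
      using dual_stft_train_comb[OF N lam, of a p] z by simp
  qed simp
  then show ?thesis using train_coeff_zero_iff[OF N] by blast
qed

section \<open>Frames and injectivity\<close>

lemma SN_coeff_train_comb:
  assumes N: "N \<ge> 1"
  shows "SN_coeff N (train_comb N a) = (\<lambda>n. if n < N then a n else 0)"
  unfolding SN_coeff_def
proof (rule the_equality, intro conjI)
  show "train_comb N a = train_comb N (\<lambda>n. if n < N then a n else 0)"
    by (auto simp: train_comb_def intro!: sum.cong)
  fix b assume b: "(\<forall>n\<ge>N. b n = 0) \<and> train_comb N a = train_comb N b"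
  have "\<forall>n<N. a n - b n = 0"
  proof (rule train_comb_zero_imp[OF N])
    fix z
    have "train_comb N a (tf_shift z (gauss 1)) = train_comb N b (tf_shift z (gauss 1))" using b by simp
    then show "dual_stft (gauss 1) (train_comb N (\<lambda>n. a n - b n)) z = 0"
      by (simp add: dual_stft_def train_comb_def left_diff_distrib sum_subtractf)
  qed simp
  then show "b = (\<lambda>n. if n < N then a n else 0)" using b by (auto simp: fun_eq_iff)
qed auto

lemma SN_norm_train_comb:
  assumes "N \<ge> 1" shows "(SN_norm N (train_comb N a))\<^sup>2 = (\<Sum>n<N. (cmod (a n))\<^sup>2)"
proof -
  have "SN_inner N (train_comb N a) (train_comb N a) = (\<Sum>n<N. a n * cnj (a n))"
    by (simp add: SN_inner_def SN_coeff_train_comb[OF assms])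
  also have "Re \<dots> = (\<Sum>n<N. (cmod (a n))\<^sup>2)"
    by (simp add: complex_norm_square[symmetric])
  finally have "Re (SN_inner N (train_comb N a) (train_comb N a)) = (\<Sum>n<N. (cmod (a n))\<^sup>2)" .
  then show ?thesis by (simp add: SN_norm_def sum_nonneg)
qed

text \<open>
  On the unit sphere, which is compact, the sum over \<open>I\<close> attains a minimum and a maximum; under
  injectivity the minimum is positive, and homogeneity extends both bounds to all \<open>a\<close>.  The
  coefficients live in \<open>nat \<Rightarrow> complex\<close>, so the sphere is cut out of a product of compact
  sets, compact by Tychonoff's theorem, in which the coordinates from \<open>N\<close> on are 0.
\<close>

lemma finite_frame_iff_injective:
  fixes T :: "nat \<Rightarrow> 'k \<Rightarrow> complex"
  assumes N: "N \<ge> 1"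
  shows "(\<exists>A>0. \<exists>B>0. \<forall>a. A * (\<Sum>n<N. (cmod (a n))\<^sup>2) \<le> (\<Sum>k\<in>I. (cmod (\<Sum>n<N. a n * T n k))\<^sup>2)
      \<and> (\<Sum>k\<in>I. (cmod (\<Sum>n<N. a n * T n k))\<^sup>2) \<le> B * (\<Sum>n<N. (cmod (a n))\<^sup>2))
    \<longleftrightarrow> (\<forall>a. (\<Sum>k\<in>I. (cmod (\<Sum>n<N. a n * T n k))\<^sup>2) = 0 \<longrightarrow> (\<forall>n<N. a n = 0))"
    (is "?frame \<longleftrightarrow> ?inj")
proof -
  define f where "f a = (\<Sum>k\<in>I. (cmod (\<Sum>n<N. a n * T n k))\<^sup>2)" for a
  define s where "s a = (\<Sum>n<N. (cmod (a n))\<^sup>2)" for a :: "nat \<Rightarrow> complex"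
  have s0: "s a = 0 \<longleftrightarrow> (\<forall>n<N. a n = 0)" for a
    unfolding s_def by (subst sum_nonneg_eq_0_iff) auto
  have f0: "f a \<ge> 0" and s_nn: "s a \<ge> 0" for a by (auto simp: f_def s_def sum_nonneg)
  have "?inj" if "A > 0" "\<forall>a. A * s a \<le> f a" for A
  proof (intro allI impI)
    fix a n assume "(\<Sum>k\<in>I. (cmod (\<Sum>n<N. a n * T n k))\<^sup>2) = 0" "n < N"
    then have "A * s a \<le> 0" using that(2)[rule_format, of a] by (simp add: f_def)
    then have "s a = 0" using \<open>A > 0\<close> s_nn[of a] by (simp add: mult_le_0_iff)
    then show "a n = 0" using s0 \<open>n < N\<close> by blast
  qed
  moreover have ?frame if inj: ?inj
  proof -
    define C where "C = (\<Pi>\<^sub>E n\<in>UNIV. if n < N then cball 0 1 else {0::complex}) \<inter> {a. s a = 1}"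
    have cs: "continuous_on UNIV s" "continuous_on UNIV f"
      unfolding s_def[abs_def] f_def[abs_def]
      by (intro continuous_intros continuous_on_product_coordinates)+
    have "compact (\<Pi>\<^sub>E n\<in>UNIV. if n < N then cball 0 1 else {0::complex})"
      using compactin_PiE[of "\<lambda>_. euclidean" UNIV "\<lambda>n. if n < N then cball 0 1 else {0::complex}"]
      by (simp add: euclidean_product_topology)
    moreover have "closed {a. s a = 1}" by (rule closed_Collect_eq[OF cs(1) continuous_on_const])
    ultimately have C: "compact C" unfolding C_def by (rule compact_Int_closed)
    define e where "e n = (if n = 0 then 1 else 0 :: complex)" for n :: nat
    have "s e = 1"
    proof -
      have "s e = (\<Sum>n<N. if n = 0 then 1 else 0)" unfolding s_def e_def by (intro sum.cong) auto
      then show ?thesis using N by (simp add: sum.delta')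
    qed
    then have "e \<in> C" using N by (auto simp: C_def PiE_iff extensional_def e_def)
    then have ne: "C \<noteq> {}" by blast
    obtain l where l: "l \<in> C" "\<And>a. a \<in> C \<Longrightarrow> f l \<le> f a"
      using continuous_attains_inf[OF C ne continuous_on_subset[OF cs(2)]] by auto
    obtain b where b: "b \<in> C" "\<And>a. a \<in> C \<Longrightarrow> f a \<le> f b"
      using continuous_attains_sup[OF C ne continuous_on_subset[OF cs(2)]] by auto
    have "f l \<noteq> 0"
    proof
      assume "f l = 0"
      then have "s l = 0" using inj s0 unfolding f_def by blast
      then show False using l(1) by (simp add: C_def)
    qed
    then have fl: "f l > 0" using f0[of l] by simp
    have "f l * s a \<le> f a \<and> f a \<le> f b * s a" for a
    proof (cases "s a = 0")
      case True
      then have "f a = 0" using s0 by (simp add: f_def)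
      then show ?thesis using True by simp
    next
      case False
      define r where "r = sqrt (s a)"
      have r: "r > 0" "r\<^sup>2 = s a" using False s_nn[of a] by (auto simp: r_def)
      define a' where "a' n = (if n < N then a n / complex_of_real r else 0)" for n
      have "s a' = (\<Sum>n<N. (cmod (a n))\<^sup>2 / r\<^sup>2)"
        unfolding s_def a'_def by (intro sum.cong) (auto simp: norm_divide power_divide)
      then have sa': "s a' = 1" using r False by (simp add: sum_divide_distrib[symmetric] s_def)
      have "norm (a' n) \<le> 1" if "n < N" for n
      proof -
        have "(cmod (a' n))\<^sup>2 \<le> s a'" unfolding s_def
          by (rule member_le_sum[of n "{..<N}" "\<lambda>n. (cmod (a' n))\<^sup>2"]) (use that in auto)
        then show ?thesis using sa' by (simp add: power_le_one_iff abs_square_le_1)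
      qed
      then have "a' \<in> C" using sa' by (auto simp: C_def a'_def)
      then have ab: "f l \<le> f a'" "f a' \<le> f b" using l b by auto
      have "(\<Sum>n<N. a' n * T n k) = (\<Sum>n<N. a n * T n k) / complex_of_real r" for k
        unfolding sum_divide_distrib a'_def by (intro sum.cong) auto
      then have "f a' = f a / s a"
        using r by (simp add: f_def norm_divide power_divide sum_divide_distrib[symmetric])
      then have "f a = f a' * s a" using False by simp
      then show ?thesis using ab s_nn[of a] by (simp add: mult_right_mono)
    qed
    moreover have "f b > 0" using fl b(2)[OF l(1)] by simp
    ultimately show ?thesis using fl unfolding f_def s_def by blast
  qed
  ultimately show ?thesis unfolding f_def s_def by blast
qed

lemma gives_frame_iff:
  assumes "N \<ge> 1"
  shows "gives_frame N g K z \<longleftrightarrow>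
    (\<forall>a. (\<forall>k\<in>{1..K}. dual_stft g (train_comb N a) (z k) = 0) \<longrightarrow> (\<forall>n<N. a n = 0))"
proof -
  have "gives_frame N g K z \<longleftrightarrow>
    (\<exists>A>0. \<exists>B>0. \<forall>a. A * (\<Sum>n<N. (cmod (a n))\<^sup>2) \<le> (\<Sum>k=1..K. (cmod (\<Sum>n<N. a n * delta_train N n (tf_shift (z k) g)))\<^sup>2)
      \<and> (\<Sum>k=1..K. (cmod (\<Sum>n<N. a n * delta_train N n (tf_shift (z k) g)))\<^sup>2) \<le> B * (\<Sum>n<N. (cmod (a n))\<^sup>2))"
  proof -
    have "dual_stft g (train_comb N a) w = (\<Sum>n<N. a n * delta_train N n (tf_shift w g))" for a w
      by (simp add: dual_stft_def train_comb_def)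
    then show ?thesis by (simp add: gives_frame_def SN_def SN_norm_train_comb[OF assms])
  qed
  also have "\<dots> \<longleftrightarrow> (\<forall>a. (\<Sum>k=1..K. (cmod (\<Sum>n<N. a n * delta_train N n (tf_shift (z k) g)))\<^sup>2) = 0 \<longrightarrow> (\<forall>n<N. a n = 0))"
    by (rule finite_frame_iff_injective[OF assms])
  also have "\<dots> \<longleftrightarrow> (\<forall>a. (\<forall>k\<in>{1..K}. dual_stft g (train_comb N a) (z k) = 0) \<longrightarrow> (\<forall>n<N. a n = 0))"
    by (subst sum_nonneg_eq_0_iff) (auto simp: dual_stft_def train_comb_def)
  finally show ?thesis .
qed

section \<open>Coefficients and points in the coordinate\<close>

text \<open>
  The difference of the squares of \<open>(m + N)/N\<close> and \<open>m/N\<close> is \<open>2 * m / N + 1\<close>.  For the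
  series this is the functional equation of a theta function of degree \<open>N\<close>.
\<close>

lemma train_coeff_recurrence:
  assumes "N \<ge> 1" "lam > 0" and q: "q = complex_of_real (exp (- (2 * pi * lam / N)))"
  shows "complex_of_real (exp (pi * lam)) * train_coeff lam N a (m + int N) = q powi m * train_coeff lam N a m"
proof -
  have "q powi m = complex_of_real (exp (- (2 * pi * lam / N)) powi m)" unfolding q by simp
  also have "exp (- (2 * pi * lam / N)) powi m = exp (of_int m * (- (2 * pi * lam / N)))" by (rule exp_power_int)
  finally have qm: "q powi m = complex_of_real (exp (of_int m * (- (2 * pi * lam / N))))" .
  have "pi * lam + - (pi * lam * (of_int (m + int N) / real N)\<^sup>2)
    = of_int m * (- (2 * pi * lam / N)) + - (pi * lam * (of_int m / real N)\<^sup>2)"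
    using assms(1) by (simp add: field_simps power2_eq_square)
  then have "exp (pi * lam) * exp (- (pi * lam * (of_int (m + int N) / real N)\<^sup>2))
    = exp (of_int m * (- (2 * pi * lam / N))) * exp (- (pi * lam * (of_int m / real N)\<^sup>2))"
    unfolding exp_add[symmetric] by (rule arg_cong)
  then have "complex_of_real (exp (pi * lam)) * complex_of_real (exp (- (pi * lam * (of_int (m + int N) / real N)\<^sup>2)))
    = q powi m * complex_of_real (exp (- (pi * lam * (of_int m / real N)\<^sup>2)))"
    unfolding qm of_real_mult[symmetric] by (rule arg_cong)
  then show ?thesis unfolding train_coeff_def by (simp add: mult_ac del: of_int_add)
qed

text \<open>
  The recurrence determines a sequence from \<open>N\<close> consecutive terms, and these can be matched freely
  by the choice of \<open>a\<close>.
\<close>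

lemma train_coeff_surj:
  assumes N: "N \<ge> 1" and lam: "lam > 0" and q: "q = complex_of_real (exp (- (2 * pi * lam / N)))"
    and c: "\<And>m. complex_of_real (exp (pi * lam)) * c (m + int N) = q powi m * c m"
  obtains a where "train_coeff lam N a = c"
proof -
  define a where "a n = c (int n) * complex_of_real (exp (pi * lam * (real n / real N)\<^sup>2))" for n
  have q0: "q \<noteq> 0" unfolding q by simp
  note rec = train_coeff_recurrence[OF N lam q, of a]
  have small: "train_coeff lam N a (int r) = c (int r)" if "r < N" for r
    using that by (simp add: train_coeff_def a_def exp_minus)
  have "train_coeff lam N a (int r + int N * k) = c (int r + int N * k)" if r: "r < N" for r k
  proof (induction k rule: int_induct[where k = 0])
    case base
    then show ?case using small[OF r] by simp
  next
    case (step1 k)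
    have "int r + int N * (k + 1) = (int r + int N * k) + int N" by (simp add: algebra_simps)
    then have "complex_of_real (exp (pi * lam)) * train_coeff lam N a (int r + int N * (k + 1)) = complex_of_real (exp (pi * lam)) * c (int r + int N * (k + 1))"
      using rec[of "int r + int N * k"] c[of "int r + int N * k"] step1 by (simp only:)
    then show ?case by simp
  next
    case (step2 k)
    have "(int r + int N * (k - 1)) + int N = int r + int N * k" by (simp add: algebra_simps)
    then have "q powi (int r + int N * (k - 1)) * train_coeff lam N a (int r + int N * (k - 1)) = q powi (int r + int N * (k - 1)) * c (int r + int N * (k - 1))"
      using rec[of "int r + int N * (k - 1)"] c[of "int r + int N * (k - 1)"] step2 by (simp only:)
    then show ?case using q0 by simp
  qed
  then have "train_coeff lam N a m = c m" for m
  proof -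
    assume *: "\<And>r k. r < N \<Longrightarrow> train_coeff lam N a (int r + int N * k) = c (int r + int N * k)"
    have "nat (m mod int N) < N" using N by (simp add: nat_less_iff)
    from *[OF this, of "m div int N"] show ?thesis using N by simp
  qed
  then show thesis using that[of a] by blast
qed

lemma tf_point_eq_imp_torus_eq:
  assumes N: "N \<ge> 1" and lam: "lam > 0" and q: "q = complex_of_real (exp (- (2 * pi * lam / N)))"
    and e: "tf_point lam N z = tf_point lam N w * q powi j"
  shows "torus_eq N z w"
proof -
  have "q powi j = exp (of_int j * complex_of_real (- (2 * pi * lam / N)))"
    unfolding q exp_of_real[symmetric] by (rule exp_power_int)
  with e have "exp (2 * of_real pi * (of_real (lam * fst z) - \<i> * of_real (snd z)) / of_nat N)
     = exp (2 * of_real pi * (of_real (lam * fst w) - \<i> * of_real (snd w)) / of_nat N + of_int j * complex_of_real (- (2 * pi * lam / N)))"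
    by (simp only: tf_point_def exp_add)
  then obtain n :: int where n: "2 * of_real pi * (of_real (lam * fst z) - \<i> * of_real (snd z)) / of_nat N
     = 2 * of_real pi * (of_real (lam * fst w) - \<i> * of_real (snd w)) / of_nat N + of_int j * complex_of_real (- (2 * pi * lam / N)) + of_int (2 * n) * pi * \<i>"
    unfolding exp_eq by blast
  have "2 * pi * (lam * fst z) / N = 2 * pi * (lam * fst w) / N - of_int j * (2 * pi * lam / N)"
    using arg_cong[OF n, of Re] by simp
  then have "2 * pi * lam / N * (fst z - fst w) = 2 * pi * lam / N * of_int (- j)"
    by (simp add: algebra_simps diff_divide_distrib)
  then have 1: "fst z - fst w = of_int (- j)" using N lam by (simp only: mult_cancel_left) simp
  have "- (2 * pi * snd z / N) = - (2 * pi * snd w / N) + 2 * of_int n * pi"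
    using arg_cong[OF n, of Im] by simp
  then have "2 * pi * (snd z - snd w) = 2 * pi * (N * of_int (- n))"
    using N by (simp add: field_simps)
  then have "snd z - snd w = real N * of_int (- n)" by (simp only: mult_cancel_left) simp
  with 1 show ?thesis unfolding torus_eq_def by blast
qed

lemma tf_point_prod:
  "(\<Prod>k\<in>I. tf_point lam N (z k)) = tf_point lam N (\<Sum>k\<in>I. z k)"
  by (induction I rule: infinite_finite_induct)
     (auto simp: tf_point_def exp_add[symmetric] add_divide_distrib[symmetric] algebra_simps)

text \<open>
  In the exponential form of both sides the real parts determine the time coordinate of \<open>p\<close>, and the
  imaginary parts its frequency coordinate up to multiples of \<open>N\<close>.  After division by \<open>N\<close>, the sign
  \<open>(-1) ^ N\<close> contributes the shift \<open>N / 2\<close> in frequency, and the multiplier \<open>exp (pi * lam)\<close> the shift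
  \<open>1 / 2\<close> in time.
\<close>

lemma tf_point_product_condition:
  assumes N: "N \<ge> 1" and lam: "lam > 0" and q: "q = complex_of_real (exp (- (2 * pi * lam / N)))"
  shows "complex_of_real (exp (pi * lam)) = (-1) ^ N * tf_point lam N p * q powi n
     \<longleftrightarrow> (\<exists>m :: int. (1 / real N) *\<^sub>R p = (1/2 + of_int n / real N, real N / 2 + of_int m))"
proof -
  have qn: "q powi n = exp (of_int n * complex_of_real (- (2 * pi * lam / N)))"
    unfolding q exp_of_real[symmetric] by (rule exp_power_int)
  have m1: "(-1) ^ N = exp (of_nat N * (of_real pi * \<i>))"
    unfolding exp_of_nat_mult by simp
  let ?R = "of_nat N * (of_real pi * \<i>) + 2 * of_real pi * (of_real (lam * fst p) - \<i> * of_real (snd p)) / of_nat N + of_int n * complex_of_real (- (2 * pi * lam / N))"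
  have "complex_of_real (exp (pi * lam)) = (-1) ^ N * tf_point lam N p * q powi n
     \<longleftrightarrow> exp (complex_of_real (pi * lam)) = exp ?R"
    unfolding exp_add qn m1 tf_point_def exp_of_real ..
  also have "\<dots> \<longleftrightarrow> (\<exists>m::int. complex_of_real (pi * lam) = ?R + of_int (2 * m) * pi * \<i>)"
    by (rule exp_eq)
  also have "\<dots> \<longleftrightarrow> (\<exists>m::int. (1 / real N) *\<^sub>R p = (1/2 + of_int n / real N, real N / 2 + of_int m))"
  proof (rule ex_cong1)
    fix m :: int
    have "complex_of_real (pi * lam) = ?R + of_int (2 * m) * pi * \<i> \<longleftrightarrow>
      pi * lam = 2 * pi * (lam * fst p) / N - of_int n * (2 * pi * lam / N) \<and>
      0 = N * pi - 2 * pi * snd p / N + 2 * of_int m * pi"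
      by (simp add: complex_eq_iff)
    also have "pi * lam = 2 * pi * (lam * fst p) / N - of_int n * (2 * pi * lam / N) \<longleftrightarrow>
       (2 * pi * lam) * (1/2) = (2 * pi * lam) * (fst p / N - of_int n / N)"
      by (simp add: algebra_simps)
    also have "\<dots> \<longleftrightarrow> fst p / N = 1/2 + of_int n / N"
    proof -
      have nz: "2 * pi * lam \<noteq> 0" using lam by simp
      show ?thesis by (simp only: mult_cancel_left nz simp_thms, rule iffI; linarith)
    qed
    also have "0 = N * pi - 2 * pi * snd p / N + 2 * of_int m * pi \<longleftrightarrow> (2 * pi) * (snd p / N) = (2 * pi) * (real N / 2 + of_int m)"
      by (auto simp: algebra_simps)
    also have "\<dots> \<longleftrightarrow> snd p / N = real N / 2 + of_int m"
      unfolding mult_cancel_left by auto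
    finally show "complex_of_real (pi * lam) = ?R + of_int (2 * m) * pi * \<i> \<longleftrightarrow>
      (1 / real N) *\<^sub>R p = (1/2 + of_int n / real N, real N / 2 + of_int m)"
      by (simp add: prod_eq_iff)
  qed
  finally show ?thesis .
qed

section \<open>Frames from points on the torus\<close>

lemma dual_stft_zero_iff:
  assumes "N \<ge> 1" "lam > 0"
    and F: "((\<lambda>m. train_coeff lam N a m * tf_point lam N z powi m) has_sum F) UNIV"
  shows "dual_stft (gauss lam) (train_comb N a) z = 0 \<longleftrightarrow> F = 0"
  using has_sum_unique[OF F dual_stft_train_comb[OF assms(1,2)]] by simp

theorem theorem16:
  fixes N K :: nat and lam :: real and z :: "nat \<Rightarrow> real \<times> real"
  assumes "N \<ge> 1"
    and "lam > 0"
    and "\<And>k. k \<in> {1..K} \<Longrightarrow> z k \<in> {0..1} \<times> {0..real N}"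
    and "\<And>j k. j \<in> {1..K} \<Longrightarrow> k \<in> {1..K} \<Longrightarrow> j \<noteq> k \<Longrightarrow> \<not> torus_eq N (z j) (z k)"
  shows "gives_frame N (gauss lam) K z \<longleftrightarrow>
    K \<ge> N + 1 \<or>
    (K = N \<and>
      (\<forall>n m :: int. (1 / real N) *\<^sub>R (\<Sum>k=1..N. z k)
         \<noteq> (1/2 + of_int n / real N, real N / 2 + of_int m)))"
proof -
  note N = assms(1) and lam = assms(2) and dist = assms(4)
  define q where "q = complex_of_real (exp (- (2 * pi * lam / N)))"
  define kap where "kap = complex_of_real (exp (pi * lam))"
  define u where "u k = tf_point lam N (z k)" for k
  have q: "q \<noteq> 0" "norm q < 1" using N lam by (auto simp: q_def)
  have kap: "kap \<noteq> 0" by (simp add: kap_def)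
  have u0: "u k \<noteq> 0" for k by (simp add: u_def tf_point_nonzero)
  have udist: "u i \<noteq> u k * q powi j" if "i \<in> {1..K}" "k \<in> {1..K}" "i \<noteq> k" for i k j
    using tf_point_eq_imp_torus_eq[OF N lam q_def] dist[OF that] unfolding u_def by blast
  show ?thesis
  proof
    assume frame: "gives_frame N (gauss lam) K z"
    show "K \<ge> N + 1 \<or> (K = N \<and> (\<forall>n m :: int. (1 / real N) *\<^sub>R (\<Sum>k=1..N. z k) \<noteq> (1/2 + of_int n / real N, real N / 2 + of_int m)))"
    proof (rule ccontr)
      assume no: "\<not> ?thesis"
      \<comment> \<open>The given points are completed to \<open>N\<close> zeros satisfying the product condition.  If \<open>K < N\<close>, the
          last zero is free and solves the condition with \<open>j = 0\<close>.\<close>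
      have "\<exists>v j. (\<forall>k\<in>{1..N}. v k \<noteq> 0) \<and> (\<forall>k\<in>{1..K}. k \<in> {1..N} \<and> v k = u k) \<and> kap = (-1) ^ N * (\<Prod>k\<in>{1..N}. v k) * q powi j"
      proof (cases "K < N")
        case True
        define p where "p = (-1) ^ N * (\<Prod>k\<in>{1..K}. u k)"
        define v where "v k = (if k \<le> K then u k else if k < N then 1 else kap / p)" for k
        have p: "p \<noteq> 0" by (simp add: p_def u0)
        have "{1..N} = {1..K} \<union> ({K<..<N} \<union> {N})" using True by auto
        then have "(\<Prod>k\<in>{1..N}. v k) = (\<Prod>k\<in>{1..K}. v k) * (\<Prod>k\<in>{K<..<N} \<union> {N}. v k)"
          using True by (simp only:) (subst prod.union_disjoint, auto)
        also have "(\<Prod>k\<in>{1..K}. v k) = (\<Prod>k\<in>{1..K}. u k)" by (intro prod.cong) (auto simp: v_def)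
        also have "(\<Prod>k\<in>{K<..<N} \<union> {N}. v k) = (\<Prod>k\<in>{K<..<N}. v k) * v N" by (subst prod.union_disjoint) auto
        also have "(\<Prod>k\<in>{K<..<N}. v k) = 1" by (intro prod.neutral) (auto simp: v_def)
        also have "v N = kap / p" using True by (simp add: v_def)
        finally have "(-1) ^ N * (\<Prod>k\<in>{1..N}. v k) * q powi 0 = p * (kap / p)" by (simp add: p_def)
        then have "kap = (-1) ^ N * (\<Prod>k\<in>{1..N}. v k) * q powi 0" using p by simp
        moreover have "v k \<noteq> 0" for k using u0 kap p by (simp add: v_def)
        moreover have "\<forall>k\<in>{1..K}. k \<in> {1..N} \<and> v k = u k" using True by (auto simp: v_def)
        ultimately show ?thesis by blast
      next
        case False
        then have KN: "K = N" using no by auto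
        then obtain n m :: int where nm: "(1 / real N) *\<^sub>R (\<Sum>k=1..N. z k) = (1/2 + of_int n / real N, real N / 2 + of_int m)"
          using no by auto
        then have "kap = (-1) ^ N * tf_point lam N (\<Sum>k=1..N. z k) * q powi n"
          unfolding kap_def using tf_point_product_condition[OF N lam q_def] by blast
        then have "kap = (-1) ^ N * (\<Prod>k\<in>{1..N}. u k) * q powi n" unfolding tf_point_prod[symmetric] u_def .
        then show ?thesis using KN u0 by (intro exI[of _ u] exI[of _ n]) auto
      qed
      then obtain v j where v: "\<And>k. k \<in> {1..N} \<Longrightarrow> v k \<noteq> 0" "\<And>k. k \<in> {1..K} \<Longrightarrow> k \<in> {1..N} \<and> v k = u k"
        "kap = (-1) ^ N * (\<Prod>k\<in>{1..N}. v k) * q powi j" by blast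
      obtain c where c: "\<And>u. u \<noteq> 0 \<Longrightarrow> ((\<lambda>m. c m * u powi m) has_sum u powi j * (\<Prod>k\<in>{1..N}. qtheta q (u / v k))) UNIV"
          "c \<noteq> (\<lambda>_. 0)" "\<And>m. kap * c (m + int N) = q powi m * c m"
        using theta_product_laurent[OF q, of "{1..N}" v j] v(1) unfolding v(3) by auto
      obtain a where a: "train_coeff lam N a = c"
        using train_coeff_surj[OF N lam q_def c(3)[unfolded kap_def]] by blast
      have "dual_stft (gauss lam) (train_comb N a) (z k) = 0" if k: "k \<in> {1..K}" for k
      proof -
        have "((\<lambda>m. train_coeff lam N a m * u k powi m) has_sum u k powi j * (\<Prod>i\<in>{1..N}. qtheta q (u k / v i))) UNIV"
          unfolding a by (rule c(1)[OF u0])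
        moreover have "qtheta q (u k / v k) = 0" using qtheta_simple_zero[OF q, of 0] v(2)[OF k] u0 by simp
        then have "(\<Prod>i\<in>{1..N}. qtheta q (u k / v i)) = 0" using v(2)[OF k] by (intro prod_zero) (auto intro!: bexI[of _ k] simp del: divide_self_if)
        ultimately show ?thesis using dual_stft_zero_iff[OF N lam] unfolding u_def by fastforce
      qed
      then have "\<forall>n<N. a n = 0" using frame unfolding gives_frame_iff[OF N] by blast
      then show False using train_coeff_zero_iff[OF N] a c(2) by metis
    qed
  next
    assume cond: "K \<ge> N + 1 \<or> (K = N \<and> (\<forall>n m :: int. (1 / real N) *\<^sub>R (\<Sum>k=1..N. z k) \<noteq> (1/2 + of_int n / real N, real N / 2 + of_int m)))"
    then have KN: "K \<ge> N" by auto
    show "gives_frame N (gauss lam) K z"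
      unfolding gives_frame_iff[OF N]
    proof (intro allI impI, rule ccontr)
      fix a n assume zero: "\<forall>k\<in>{1..K}. dual_stft (gauss lam) (train_comb N a) (z k) = 0" and "n < N" "a n \<noteq> 0"
      then have nz: "train_coeff lam N a \<noteq> (\<lambda>_. 0)" using train_coeff_zero_iff[OF N] by blast
      \<comment> \<open>A nonzero \<open>a\<close> whose transform vanishes at all points gives a theta function to which
          the factorization at the first \<open>N\<close> points applies.\<close>
      define F where "F w = (\<Sum>\<^sub>\<infinity>m. train_coeff lam N a m * w powi m)" for w
      have F: "((\<lambda>m. train_coeff lam N a m * w powi m) has_sum F w) UNIV" if w0: "w \<noteq> 0" for w
      proof -
        obtain p where "w = tf_point lam N p" using tf_point_surj[OF N lam w0] .
        then show ?thesis unfolding F_def using has_sum_imp_summable[OF dual_stft_train_comb[OF N lam, of a p]] by (intro has_sum_infsum) simp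
      qed
      have Fu: "F (u k) = 0" if "k \<in> {1..K}" for k
        using dual_stft_zero_iff[OF N lam F[OF u0[of k], unfolded u_def]] zero that by (simp add: u_def)
      have "\<exists>w. w \<noteq> 0 \<and> F w \<noteq> 0"
      proof (rule ccontr)
        assume "\<not> (\<exists>w. w \<noteq> 0 \<and> F w \<noteq> 0)"
        then have "((\<lambda>m. train_coeff lam N a m * w powi m) has_sum 0) UNIV" if "w \<noteq> 0" for w
          using F[OF that] that by auto
        then have "train_coeff lam N a = (\<lambda>_. 0)"
          by (rule laurent_coeffs_unique[where F = "\<lambda>_. 0"]) simp_all
        then show False using nz by contradiction
      qed
      then obtain w where w: "w \<noteq> 0" "F w \<noteq> 0" by blast
      have hol: "F holomorphic_on -{0}"
      proof -
        obtain f g where fg: "f holomorphic_on UNIV" "g holomorphic_on UNIV"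
            "f 0 = train_coeff lam N a 0" "g 0 = 0" "\<And>w. w \<noteq> 0 \<Longrightarrow> F w = f w + g (1 / w)"
          by (rule laurent_split[of "train_coeff lam N a" F]) (use F in auto)
        have "(\<lambda>w. f w + g (1 / w)) holomorphic_on -{0}"
          by (intro holomorphic_intros holomorphic_on_compose_gen[OF _ fg(2), unfolded o_def] holomorphic_on_subset[OF fg(1)]) auto
        then show ?thesis by (rule holomorphic_transform) (use fg(5) in auto)
      qed
      have shift: "F (q * w) = kap / w ^ card {1..N} * F w" if w: "w \<noteq> 0" for w
      proof -
        have "((\<lambda>m. kap * w powi (- int N) * (train_coeff lam N a m * w powi m)) has_sum kap * w powi (- int N) * F w) UNIV"
          by (rule has_sum_cmult_right[OF F[OF w]])
        then have "((\<lambda>m. kap * train_coeff lam N a (m + int N) * w powi m) has_sum kap * w powi (- int N) * F w) UNIV"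
          by (rule has_sum_reindex_bij_witness[THEN iffD1, of UNIV "\<lambda>m. m + int N" "\<lambda>m. m - int N", rotated 6])
             (use w in \<open>auto simp: power_int_diff power_int_minus field_simps\<close>)
        then have "((\<lambda>m. train_coeff lam N a m * (q * w) powi m) has_sum kap * w powi (- int N) * F w) UNIV"
          using train_coeff_recurrence[OF N lam q_def, of a, folded kap_def] by (simp add: power_int_mult_distrib mult_ac)
        then have "F (q * w) = kap * w powi (- int N) * F w"
          using has_sum_unique[OF F[of "q * w"]] w q by simp
        then show ?thesis by (simp add: power_int_minus divide_inverse)
      qed
      obtain h j where hj: "h \<noteq> 0" "kap = (-1) ^ card {1..N} * (\<Prod>k\<in>{1..N}. u k) * q powi j"
        "\<And>w. w \<noteq> 0 \<Longrightarrow> F w = h * w powi j * (\<Prod>k\<in>{1..N}. qtheta q (w / u k))"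
        by (rule theta_factorization[of q "{1..N}" u F kap w])
           (use q u0 udist hol shift kap Fu w KN in \<open>auto\<close>)
      show False
      proof (cases "K = N")
        case True
        have "kap = (-1) ^ N * tf_point lam N (\<Sum>k=1..N. z k) * q powi j"
          unfolding tf_point_prod[symmetric] using hj(2) by (simp add: u_def)
        then show False
          using True cond tf_point_product_condition[OF N lam q_def] unfolding kap_def by auto
      next
        case False
        then have K: "N + 1 \<in> {1..K}" using KN by auto
        have "(\<Prod>k\<in>{1..N}. qtheta q (u (N + 1) / u k)) = 0"
          using hj(3)[OF u0[of "N + 1"]] Fu[OF K] hj(1) u0 by simp
        then obtain k where k: "k \<in> {1..N}" "qtheta q (u (N + 1) / u k) = 0" by auto
        obtain l where "u (N + 1) / u k = q powi l" using qtheta_zero_imp[OF q k(2)] u0 by auto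
        then have "u (N + 1) = u k * q powi l" using u0[of k] by (simp add: field_simps)
        then show False using udist[OF K, of k l] k(1) KN by auto
      qed
    qed
  qed
qed

end
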